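(* Let $I\subset\mathbb{R}$ be an interval and let $K_\Omega$ be a partial covariance on a serrated domain $\Omega=\bigcup_{j=1}^m(I_j\times I_j)\subset I\times I$ of $m$ intervals, indexed in their natural order. The following two statements are equivalent: (I) $K_\Omega$ admits a unique completion on $I$, i.e. $\mathscr{C}(K_\Omega)$ is a singleton. (II) There exists $r\in\{1,\dots,m\}$ such that $$K_{I_p}/K_{I_p\cap I_{p+1}}=0\ \text{ for } 1\le p<r\qquad\text{and}\qquad K_{I_{q+1}}/K_{I_q\cap I_{q+1}}=0\ \text{ for } r\le q<m.$$
   Context: A covariance on a set $S$ is a symmetric function $K:S\times S\to\mathbb{R}$ with $\sum_{i,j=1}^n\alpha_i\alpha_jK(t_i,t_j)\ge 0$ for all $n\ge1$, $t_i\in S$, $\alpha_i\in\mathbb{R}$. A serrated domain is $\Omega=\bigcup_{j=1}^m (I_j\times I_j)$ with $\{I_j\}_{j=1}^m$ a finite collection of (nonempty) subintervals covering $I$; natural order means that for $p<q$ every point of $I_p\setminus I_q$ lies to the left of every point of $I_q$ and every point of $I_q\setminus I_p$ lies to the right of every point of $I_p$. A partial covariance on $\Omega$ is a function $K_\Omega:\Omega\to\mathbb{R}$ such that for every $J\subset I$ (not necessarily an interval) with $J\times J\subset\Omega$, the restriction $K_J=K_\Omega|_{J\times J}$ is a covariance on $J$. A completion of $K_\Omega$ is a covariance $K$ on $I$ with $K|_\Omega=K_\Omega$; the set of completions is $\mathscr{C}(K_\Omega)$. $\mathscr{H}(K_A)$ is the reproducing kernel Hilbert space of $K_A$ ($\mathscr{H}(K_\emptyset)=\{0\}$).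 For $A\subset B$ with $K_B$ a covariance on $B$ and $K_A=K_B|_{A\times A}$, the Schur complement of $K_B$ with respect to $K_A$ is the function on $(B\setminus A)\times(B\setminus A)$ $$(K_B/K_A)(s,t)=K_B(s,t)-\big\langle K_B(s,\cdot),K_B(\cdot,t)\big\rangle_{\mathscr{H}(K_A)},$$ where the functions in the inner product are restricted to $A$. *)

theory Defs
  imports "HOL-Analysis.Analysis"
begin

text \<open>
  A real function on a set \<open>S\<close> is represented either by any total function, of which only the
  values on \<open>S\<close> are used, or, where equality of functions matters (elements of a function space,
  completions), by its representative in \<^term>\<open>extensional S\<close>.
\<close>

definition covariance_on :: "'a set \<Rightarrow> ('a \<times> 'a \<Rightarrow> real) \<Rightarrow> bool" where
  "covariance_on S K \<longleftrightarrow>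
     (\<forall>s\<in>S. \<forall>t\<in>S. K (s, t) = K (t, s)) \<and>
     (\<forall>n\<ge>1. \<forall>(t :: nat \<Rightarrow> 'a) (\<alpha> :: nat \<Rightarrow> real). (\<forall>i\<in>{1..n}. t i \<in> S) \<longrightarrow>
        (\<Sum>i=1..n. \<Sum>j=1..n. \<alpha> i * \<alpha> j * K (t i, t j)) \<ge> 0)"

definition partial_covariance_on ::
    "'a set \<Rightarrow> ('a \<times> 'a) set \<Rightarrow> ('a \<times> 'a \<Rightarrow> real) \<Rightarrow> bool" where
  "partial_covariance_on I \<Omega> K \<longleftrightarrow> (\<forall>J. J \<subseteq> I \<and> J \<times> J \<subseteq> \<Omega> \<longrightarrow> covariance_on J K)"

definition completions ::
    "'a set \<Rightarrow> ('a \<times> 'a) set \<Rightarrow> ('a \<times> 'a \<Rightarrow> real) \<Rightarrow> ('a \<times> 'a \<Rightarrow> real) set" where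
  "completions I \<Omega> K =
     {L \<in> extensional (I \<times> I). covariance_on I L \<and> (\<forall>x\<in>\<Omega>. L x = K x)}"

definition interval_cover :: "real set \<Rightarrow> nat \<Rightarrow> (nat \<Rightarrow> real set) \<Rightarrow> bool" where
  "interval_cover I m J \<longleftrightarrow>
     m \<ge> 1 \<and> (\<forall>j\<in>{1..m}. is_interval (J j) \<and> J j \<noteq> {} \<and> J j \<subseteq> I) \<and> (\<Union>j\<in>{1..m}. J j) = I"

definition naturally_ordered :: "nat \<Rightarrow> (nat \<Rightarrow> real set) \<Rightarrow> bool" where
  "naturally_ordered m J \<longleftrightarrow>
     (\<forall>p\<in>{1..m}. \<forall>q\<in>{1..m}. p < q \<longrightarrow>
        (\<forall>x\<in>J p - J q. \<forall>y\<in>J q. x < y) \<and> (\<forall>y\<in>J q - J p. \<forall>x\<in>J p. x < y))"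

definition serrated_domain :: "nat \<Rightarrow> (nat \<Rightarrow> real set) \<Rightarrow> (real \<times> real) set" where
  "serrated_domain m J = (\<Union>j\<in>{1..m}. J j \<times> J j)"

text \<open>
  A Hilbert space of real functions on \<open>A\<close>, with the pointwise operations: \<open>H\<close> is the carrier and
  only the values of \<open>ip\<close> on \<open>H \<times> H\<close> matter. For empty \<open>A\<close> the only such space is \<open>{0}\<close>.
\<close>

locale function_hilbert_space =
  fixes A :: "'a set"
    and H :: "('a \<Rightarrow> real) set"
    and ip :: "('a \<Rightarrow> real) \<Rightarrow> ('a \<Rightarrow> real) \<Rightarrow> real"
  assumes carrier: "H \<subseteq> extensional A"
    and zero: "(\<lambda>x\<in>A. 0) \<in> H"
    and add: "\<lbrakk>f \<in> H; g \<in> H\<rbrakk> \<Longrightarrow> (\<lambda>x\<in>A. f x + g x) \<in> H"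
    and scale: "f \<in> H \<Longrightarrow> (\<lambda>x\<in>A. c * f x) \<in> H"
    and ip_commute: "\<lbrakk>f \<in> H; g \<in> H\<rbrakk> \<Longrightarrow> ip f g = ip g f"
    and ip_add: "\<lbrakk>f \<in> H; g \<in> H; h \<in> H\<rbrakk> \<Longrightarrow> ip (\<lambda>x\<in>A. f x + g x) h = ip f h + ip g h"
    and ip_scale: "\<lbrakk>f \<in> H; g \<in> H\<rbrakk> \<Longrightarrow> ip (\<lambda>x\<in>A. c * f x) g = c * ip f g"
    and ip_nonneg: "f \<in> H \<Longrightarrow> ip f f \<ge> 0"
    and ip_definite: "\<lbrakk>f \<in> H; ip f f = 0\<rbrakk> \<Longrightarrow> f = (\<lambda>x\<in>A. 0)"
    and complete:
      "\<lbrakk>range F \<subseteq> H;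
        \<And>e. e > 0 \<Longrightarrow> \<exists>N. \<forall>i\<ge>N. \<forall>j\<ge>N.
          sqrt (ip (\<lambda>x\<in>A. F i x - F j x) (\<lambda>x\<in>A. F i x - F j x)) < e\<rbrakk>
       \<Longrightarrow> \<exists>f\<in>H. (\<lambda>n. sqrt (ip (\<lambda>x\<in>A. F n x - f x) (\<lambda>x\<in>A. F n x - f x))) \<longlonglongrightarrow> 0"

locale rkhs = function_hilbert_space A H ip
  for A :: "'a set" and K :: "'a \<times> 'a \<Rightarrow> real"
    and H :: "('a \<Rightarrow> real) set"
    and ip :: "('a \<Rightarrow> real) \<Rightarrow> ('a \<Rightarrow> real) \<Rightarrow> real" +
  assumes kernel: "s \<in> A \<Longrightarrow> (\<lambda>x\<in>A. K (s, x)) \<in> H"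
    and reproducing: "\<lbrakk>f \<in> H; s \<in> A\<rbrakk> \<Longrightarrow> ip f (\<lambda>x\<in>A. K (s, x)) = f s"

text \<open>
  By the Moore--Aronszajn theorem a covariance \<open>K\<close> on \<open>A\<close> has exactly one reproducing kernel
  Hilbert space (\<open>ip\<close> being unique on \<open>H \<times> H\<close>), so the description below determines the
  inner product of any two of its elements.
\<close>

definition rkhs_inner ::
    "'a set \<Rightarrow> ('a \<times> 'a \<Rightarrow> real) \<Rightarrow> ('a \<Rightarrow> real) \<Rightarrow> ('a \<Rightarrow> real) \<Rightarrow> real" where
  "rkhs_inner A K f g = (THE v. \<exists>H ip. rkhs A K H ip \<and> f \<in> H \<and> g \<in> H \<and> ip f g = v)"

text \<open>\<open>schur_complement K B A\<close> is \<open>K_B/K_A\<close> for \<open>K_B\<close> and \<open>K_A\<close> the restrictions of \<open>K\<close>.\<close>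

definition schur_complement ::
    "('a \<times> 'a \<Rightarrow> real) \<Rightarrow> 'a set \<Rightarrow> 'a set \<Rightarrow> ('a \<times> 'a \<Rightarrow> real)" where
  "schur_complement K B A =
     (\<lambda>(s, t)\<in>(B - A) \<times> (B - A).
        K (s, t) - rkhs_inner A K (\<lambda>x\<in>A. K (s, x)) (\<lambda>x\<in>A. K (x, t)))"

end

theory Submission
  imports Defs
begin

text \<open>
  A covariance is the Gram kernel of a family of vectors \<open>k\<^sub>s\<close> in a Hilbert space, and
  \<open>K\<^sub>B/K\<^sub>A\<close> is the Gram kernel of what remains of the \<open>k\<^sub>s\<close>, \<open>s \<in> B\<close>, after projection
  onto the orthogonal complement of the span of the \<open>k\<^sub>a\<close>, \<open>a \<in> A\<close>. It vanishes iff every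
  \<open>k\<^sub>s\<close> lies in the closed span of the \<open>k\<^sub>a\<close> (\<open>schur_complement_zero_iff\<close>).
  So (II) says that all vectors belonging to \<open>I\<^sub>1, \<dots>, I\<^sub>m\<close> can be approximated, one overlap at a
  time, by vectors belonging to a single \<open>I\<^sub>r\<close>.

  The natural order makes the union of consecutive intervals up to \<open>I\<^sub>p\<close> meet the union of those
  from \<open>I\<^sub>p\<^sub>+\<^sub>1\<close> on in \<open>I\<^sub>p \<inter> I\<^sub>p\<^sub>+\<^sub>1\<close> only (\<open>naturally_ordered_cut\<close>). Hence completions can be
  built by gluing two covariances along the intersection \<open>C\<close> of their domains: project both
  families onto the space of \<open>C\<close> and make the two residual families orthogonal
  (\<open>amalgamate_covariances\<close>).

  If (II) holds, the approximations determine all covariances between a point already reached and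
  a point of the next interval, so two completions agree (\<open>covariances_agree_on_union\<close>), first
  to the right of \<open>I\<^sub>r\<close> and then to its left.

  If (II) fails, there are \<open>p \<le> q\<close> such that \<open>K\<close> has a nonzero Schur complement on \<open>I\<^sub>p\<close> with
  respect to \<open>I\<^sub>p \<inter> I\<^sub>p\<^sub>+\<^sub>1\<close> and on \<open>I\<^sub>q\<^sub>+\<^sub>1\<close> with respect to \<open>I\<^sub>q \<inter> I\<^sub>q\<^sub>+\<^sub>1\<close>. For the largest
  such \<open>p \<le> q\<close>, the vectors of \<open>I\<^sub>p\<^sub>+\<^sub>1, \<dots>, I\<^sub>q\<close> all lie in the closed span of
  \<open>I\<^sub>q \<inter> I\<^sub>q\<^sub>+\<^sub>1\<close>. Cutting at \<open>C = I\<^sub>p \<inter> I\<^sub>p\<^sub>+\<^sub>1\<close>, there is then a point on either side with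
  nonzero residual with respect to \<open>C\<close>. The two residuals need not be glued orthogonally: they can
  be correlated positively or negatively, and this gives two completions (\<open>two_amalgamations\<close>).

  Vectors are represented by finitely supported coefficient functions with the seminorm given by
  \<open>K\<close>, and the norm of the reproducing kernel Hilbert space is computed as the supremum
  \<open>\<parallel>f\<parallel>\<^sup>2 = sup\<^sub>\<alpha> (2 \<Sum> \<alpha>\<^sub>s f(s) - \<Sum> \<alpha>\<^sub>s \<alpha>\<^sub>t K(s,t))\<close>. Evaluated at a section
  \<open>K(s,\<cdot>)\<close> with \<open>\<alpha>\<close> supported in \<open>A\<close>, this supremum falls short of \<open>K(s,s)\<close> by exactly the
  squared distance of \<open>k\<^sub>s\<close> from the span of \<open>A\<close>, which is what links the Schur complement to
  closed spans.
\<close>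

section \<open>Finitely supported coefficients and covariances\<close>

text \<open>
  A finitely supported \<open>\<alpha>\<close> stands for the combination \<open>\<Sum> \<alpha>\<^sub>s k\<^sub>s\<close> of kernel vectors. Pairing with
  it is the functional \<open>f \<mapsto> \<langle>f, \<Sum> \<alpha>\<^sub>s k\<^sub>s\<rangle>\<close>, and \<open>form K\<close> is the inner product of two
  combinations.
\<close>

definition fsupp :: "'a set \<Rightarrow> ('a \<Rightarrow> real) set" where
  "fsupp A = {\<alpha>. finite {x. \<alpha> x \<noteq> 0} \<and> {x. \<alpha> x \<noteq> 0} \<subseteq> A}"

definition pairing :: "('a \<Rightarrow> real) \<Rightarrow> ('a \<Rightarrow> real) \<Rightarrow> real" where
  "pairing \<alpha> f = (\<Sum>x\<in>{x. \<alpha> x \<noteq> 0}. \<alpha> x * f x)"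

definition form :: "('a \<times> 'a \<Rightarrow> real) \<Rightarrow> ('a \<Rightarrow> real) \<Rightarrow> ('a \<Rightarrow> real) \<Rightarrow> real" where
  "form K \<alpha> \<beta> = pairing \<alpha> (\<lambda>s. pairing \<beta> (\<lambda>t. K (s, t)))"

definition delta :: "'a \<Rightarrow> 'a \<Rightarrow> real" where
  "delta s = (\<lambda>x. if x = s then 1 else 0)"

lemma pairing_eq_sum:
  assumes "finite F" "{x. \<alpha> x \<noteq> 0} \<subseteq> F"
  shows "pairing \<alpha> f = (\<Sum>x\<in>F. \<alpha> x * f x)"
  unfolding pairing_def using assms by (intro sum.mono_neutral_left) auto

lemma fsupp_lincomb:
  assumes "\<alpha> \<in> fsupp A" "\<beta> \<in> fsupp A"
  shows "(\<lambda>x. a * \<alpha> x + b * \<beta> x) \<in> fsupp A"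
proof -
  have "{x. a * \<alpha> x + b * \<beta> x \<noteq> 0} \<subseteq> {x. \<alpha> x \<noteq> 0} \<union> {x. \<beta> x \<noteq> 0}" by auto
  then show ?thesis using assms finite_subset unfolding fsupp_def by blast
qed

lemma fsupp_diff: "\<alpha> \<in> fsupp A \<Longrightarrow> \<beta> \<in> fsupp A \<Longrightarrow> (\<lambda>x. \<alpha> x - \<beta> x) \<in> fsupp A"
  using fsupp_lincomb[of \<alpha> A \<beta> 1 "-1"] by simp

lemma fsupp_scale: "\<alpha> \<in> fsupp A \<Longrightarrow> (\<lambda>x. c * \<alpha> x) \<in> fsupp A"
  using fsupp_lincomb[of \<alpha> A \<alpha> c 0] by simp

lemma zero_in_fsupp: "(\<lambda>x. 0) \<in> fsupp A"
  by (simp add: fsupp_def)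

lemma delta_in_fsupp: "s \<in> A \<Longrightarrow> delta s \<in> fsupp A"
  by (simp add: fsupp_def delta_def)

lemma fsupp_mono: "\<alpha> \<in> fsupp A \<Longrightarrow> A \<subseteq> B \<Longrightarrow> \<alpha> \<in> fsupp B"
  by (auto simp: fsupp_def)

lemma pairing_cong: "\<alpha> \<in> fsupp A \<Longrightarrow> (\<And>x. x \<in> A \<Longrightarrow> f x = g x) \<Longrightarrow> pairing \<alpha> f = pairing \<alpha> g"
  unfolding pairing_def fsupp_def by (intro sum.cong) auto

lemma pairing_lincomb_left:
  assumes "\<alpha> \<in> fsupp A" "\<beta> \<in> fsupp A"
  shows "pairing (\<lambda>x. a * \<alpha> x + b * \<beta> x) f = a * pairing \<alpha> f + b * pairing \<beta> f"
proof -
  define F where "F = {x. \<alpha> x \<noteq> 0} \<union> {x. \<beta> x \<noteq> 0}"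
  have F: "finite F" using assms by (auto simp: F_def fsupp_def)
  have "pairing (\<lambda>x. a * \<alpha> x + b * \<beta> x) f = (\<Sum>x\<in>F. (a * \<alpha> x + b * \<beta> x) * f x)"
    by (rule pairing_eq_sum[OF F]) (auto simp: F_def)
  also have "\<dots> = a * (\<Sum>x\<in>F. \<alpha> x * f x) + b * (\<Sum>x\<in>F. \<beta> x * f x)"
    by (simp add: sum_distrib_left sum.distrib algebra_simps)
  also have "(\<Sum>x\<in>F. \<alpha> x * f x) = pairing \<alpha> f"
    by (rule pairing_eq_sum[OF F, symmetric]) (auto simp: F_def)
  also have "(\<Sum>x\<in>F. \<beta> x * f x) = pairing \<beta> f"
    by (rule pairing_eq_sum[OF F, symmetric]) (auto simp: F_def)
  finally show ?thesis .
qed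

lemma pairing_add_right: "pairing \<alpha> (\<lambda>x. f x + g x) = pairing \<alpha> f + pairing \<alpha> g"
  by (simp add: pairing_def sum.distrib algebra_simps)

lemma pairing_diff_right: "pairing \<alpha> (\<lambda>x. f x - g x) = pairing \<alpha> f - pairing \<alpha> g"
  by (simp add: pairing_def sum_subtractf algebra_simps)

lemma pairing_scale_right: "pairing \<alpha> (\<lambda>x. c * f x) = c * pairing \<alpha> f"
  by (simp add: pairing_def sum_distrib_left algebra_simps)

lemma pairing_zero_right [simp]: "pairing \<alpha> (\<lambda>x. 0) = 0"
  by (simp add: pairing_def)

lemma pairing_zero_left [simp]: "pairing (\<lambda>x. 0) f = 0"
  by (simp add: pairing_def)

lemma pairing_delta [simp]: "pairing (delta s) f = f s"
  by (simp add: pairing_def delta_def)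

lemma pairing_swap: "pairing \<alpha> (\<lambda>s. pairing \<beta> (\<lambda>t. G s t)) = pairing \<beta> (\<lambda>t. pairing \<alpha> (\<lambda>s. G s t))"
  unfolding pairing_def sum_distrib_left by (subst sum.swap) (simp add: mult.left_commute)

lemma form_zero [simp]: "form K (\<lambda>x. 0) \<beta> = 0" "form K \<alpha> (\<lambda>x. 0) = 0"
  by (simp_all add: form_def)

lemma form_cong:
  assumes "\<alpha> \<in> fsupp A" "\<beta> \<in> fsupp B" "\<And>s t. s \<in> A \<Longrightarrow> t \<in> B \<Longrightarrow> K (s, t) = L (s, t)"
  shows "form K \<alpha> \<beta> = form L \<alpha> \<beta>"
  unfolding form_def
  by (intro pairing_cong[OF assms(1)] pairing_cong[OF assms(2)] assms(3))

lemma form_rank_one: "form (\<lambda>(s, t). u s * v t) \<alpha> \<beta> = pairing \<alpha> u * pairing \<beta> v"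
proof -
  have "form (\<lambda>(s, t). u s * v t) \<alpha> \<beta> = pairing \<alpha> (\<lambda>s. pairing \<beta> v * u s)"
    by (simp add: form_def pairing_scale_right mult.commute)
  then show ?thesis by (simp add: pairing_scale_right)
qed

lemma form_add: "form (\<lambda>p. K p + L p) \<alpha> \<beta> = form K \<alpha> \<beta> + form L \<alpha> \<beta>"
  by (simp add: form_def pairing_add_right)

lemma form_diff: "form (\<lambda>(s, t). K (s, t) - L (s, t)) \<alpha> \<beta> = form K \<alpha> \<beta> - form L \<alpha> \<beta>"
  by (simp add: form_def pairing_diff_right)

lemma form_delta_left [simp]: "form K (delta s) \<beta> = pairing \<beta> (\<lambda>t. K (s, t))"
  by (simp add: form_def)

lemma form_lincomb_left:
  assumes "\<alpha> \<in> fsupp A" "\<beta> \<in> fsupp A"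
  shows "form K (\<lambda>x. a * \<alpha> x + b * \<beta> x) \<gamma> = a * form K \<alpha> \<gamma> + b * form K \<beta> \<gamma>"
  by (simp add: form_def pairing_lincomb_left[OF assms])

lemma form_lincomb_right:
  assumes "\<alpha> \<in> fsupp A" "\<beta> \<in> fsupp A"
  shows "form K \<gamma> (\<lambda>x. a * \<alpha> x + b * \<beta> x) = a * form K \<gamma> \<alpha> + b * form K \<gamma> \<beta>"
  by (simp add: form_def pairing_lincomb_left[OF assms] pairing_add_right pairing_scale_right)

lemma form_commute:
  assumes "covariance_on A K" "\<alpha> \<in> fsupp A" "\<beta> \<in> fsupp A"
  shows "form K \<alpha> \<beta> = form K \<beta> \<alpha>"
proof -
  have "form K \<alpha> \<beta> = pairing \<beta> (\<lambda>t. pairing \<alpha> (\<lambda>s. K (s, t)))"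
    unfolding form_def by (rule pairing_swap)
  also have "\<dots> = form K \<beta> \<alpha>"
    unfolding form_def by (intro pairing_cong[OF assms(2)] pairing_cong[OF assms(3)])
      (use assms(1) in \<open>simp add: covariance_on_def\<close>)
  finally show ?thesis .
qed

lemma form_square:
  assumes "covariance_on A K" "\<alpha> \<in> fsupp A" "\<beta> \<in> fsupp A"
  shows "form K (\<lambda>x. a * \<alpha> x + b * \<beta> x) (\<lambda>x. a * \<alpha> x + b * \<beta> x)
     = a\<^sup>2 * form K \<alpha> \<alpha> + 2 * a * b * form K \<alpha> \<beta> + b\<^sup>2 * form K \<beta> \<beta>"
  using form_commute[OF assms]
  by (simp add: form_lincomb_left[OF assms(2,3)] form_lincomb_right[OF assms(2,3)]
      power2_eq_square algebra_simps)

lemma covariance_on_iff_form: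
  "covariance_on S K \<longleftrightarrow>
     (\<forall>s\<in>S. \<forall>t\<in>S. K (s, t) = K (t, s)) \<and> (\<forall>\<alpha>\<in>fsupp S. form K \<alpha> \<alpha> \<ge> 0)"
proof (intro iffI conjI)
  assume cov: "covariance_on S K"
  then show "\<forall>s\<in>S. \<forall>t\<in>S. K (s, t) = K (t, s)" by (simp add: covariance_on_def)
  show "\<forall>\<alpha>\<in>fsupp S. form K \<alpha> \<alpha> \<ge> 0"
  proof
    fix \<alpha> assume \<alpha>: "\<alpha> \<in> fsupp S"
    define F where "F = {x. \<alpha> x \<noteq> 0}"
    have F: "finite F" "F \<subseteq> S" using \<alpha> by (auto simp: F_def fsupp_def)
    obtain t where t: "bij_betw t {1..card F} F" using ex_bij_betw_nat_finite_1[OF F(1)] by blast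
    show "form K \<alpha> \<alpha> \<ge> 0"
    proof (cases "F = {}")
      case True
      then have "\<alpha> = (\<lambda>x. 0)" by (auto simp: F_def)
      then show ?thesis by simp
    next
      case False
      then have n: "card F \<ge> 1" using F(1) by (simp add: Suc_leI card_gt_0_iff)
      have tS: "\<forall>i\<in>{1..card F}. t i \<in> S" using t F(2) bij_betwE by blast
      have "0 \<le> (\<Sum>i=1..card F. \<Sum>j=1..card F. \<alpha> (t i) * \<alpha> (t j) * K (t i, t j))"
        using cov[unfolded covariance_on_def, THEN conjunct2, rule_format, of "card F" t "\<lambda>i. \<alpha> (t i)"] n tS
        by blast
      also have "\<dots> = (\<Sum>x\<in>F. \<Sum>j=1..card F. \<alpha> x * \<alpha> (t j) * K (x, t j))"
        by (rule sum.reindex_bij_betw[OF t, of "\<lambda>x. \<Sum>j=1..card F. \<alpha> x * \<alpha> (t j) * K (x, t j)"])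
      also have "\<dots> = (\<Sum>x\<in>F. \<Sum>y\<in>F. \<alpha> x * \<alpha> y * K (x, y))"
        by (intro sum.cong refl sum.reindex_bij_betw[OF t, of "\<lambda>y. \<alpha> _ * \<alpha> y * K (_, y)"])
      also have "\<dots> = form K \<alpha> \<alpha>"
        by (simp add: form_def pairing_def F_def sum_distrib_left mult.assoc)
      finally show ?thesis .
    qed
  qed
next
  assume K: "(\<forall>s\<in>S. \<forall>t\<in>S. K (s, t) = K (t, s)) \<and> (\<forall>\<alpha>\<in>fsupp S. form K \<alpha> \<alpha> \<ge> 0)"
  have "(\<Sum>i=1..n. \<Sum>j=1..n. \<alpha> i * \<alpha> j * K (t i, t j)) \<ge> 0"
    if t: "\<forall>i\<in>{1..n}. t i \<in> S" for n :: nat and t :: "nat \<Rightarrow> 'a" and \<alpha> :: "nat \<Rightarrow> real"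
  proof -
    \<comment> \<open>Points may repeat among the \<open>t i\<close>, so the coefficients over each point are collected.\<close>
    define a where "a x = (\<Sum>i\<in>{i\<in>{1..n}. t i = x}. \<alpha> i)" for x
    have supp: "{x. a x \<noteq> 0} \<subseteq> t ` {1..n}"
    proof (rule subsetI, rule ccontr)
      fix x assume x: "x \<in> {x. a x \<noteq> 0}" "x \<notin> t ` {1..n}"
      then have "{i\<in>{1..n}. t i = x} = {}" by blast
      then have "a x = 0" unfolding a_def by (simp only: sum.empty)
      then show False using x by simp
    qed
    then have a: "a \<in> fsupp S"
      using t unfolding fsupp_def by (auto intro: finite_subset)
    have collect: "(\<Sum>i=1..n. \<alpha> i * g (t i)) = pairing a g" for g
    proof -
      have "(\<Sum>i=1..n. \<alpha> i * g (t i))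
          = (\<Sum>x\<in>t ` {1..n}. \<Sum>i\<in>{i\<in>{1..n}. t i = x}. \<alpha> i * g (t i))"
        by (rule sum.image_gen) simp
      also have "\<dots> = (\<Sum>x\<in>t ` {1..n}. a x * g x)"
        unfolding a_def sum_distrib_right by (intro sum.cong) auto
      also have "\<dots> = pairing a g"
        using supp by (intro pairing_eq_sum[symmetric]) auto
      finally show ?thesis .
    qed
    have "(\<Sum>i=1..n. \<Sum>j=1..n. \<alpha> i * \<alpha> j * K (t i, t j))
        = (\<Sum>i=1..n. \<alpha> i * (\<Sum>j=1..n. \<alpha> j * K (t i, t j)))"
      by (simp add: sum_distrib_left mult.assoc)
    also have "\<dots> = form K a a"
      unfolding form_def collect[of "\<lambda>y. K (_, y)"] by (rule collect)
    finally show ?thesis using K a by simp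
  qed
  then show "covariance_on S K" using K unfolding covariance_on_def by blast
qed

lemma covariance_commute: "covariance_on S K \<Longrightarrow> s \<in> S \<Longrightarrow> t \<in> S \<Longrightarrow> K (s, t) = K (t, s)"
  by (simp add: covariance_on_def)

lemma covariance_form_nonneg: "covariance_on S K \<Longrightarrow> \<alpha> \<in> fsupp S \<Longrightarrow> form K \<alpha> \<alpha> \<ge> 0"
  by (simp add: covariance_on_iff_form)

lemma covariance_subset: "covariance_on B K \<Longrightarrow> A \<subseteq> B \<Longrightarrow> covariance_on A K"
  unfolding covariance_on_iff_form using fsupp_mono[of _ A B] by blast

lemma covariance_cong:
  assumes "covariance_on S K" "\<And>s t. s \<in> S \<Longrightarrow> t \<in> S \<Longrightarrow> L (s, t) = K (s, t)"
  shows "covariance_on S L"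
  using assms(1) form_cong[of _ S _ S L K] assms(2) unfolding covariance_on_iff_form by simp

lemma covariance_add:
  "covariance_on S K \<Longrightarrow> covariance_on S L \<Longrightarrow> covariance_on S (\<lambda>p. K p + L p)"
  unfolding covariance_on_iff_form by (simp add: form_add)

lemma covariance_extend_by_zero:
  assumes "covariance_on A K"
  shows "covariance_on X (\<lambda>(s, t). if s \<in> A \<and> t \<in> A then K (s, t) else 0)"
  unfolding covariance_on_iff_form
proof (intro conjI ballI)
  fix \<alpha> assume \<alpha>: "\<alpha> \<in> fsupp X"
  define \<beta> where "\<beta> x = (if x \<in> A then \<alpha> x else 0)" for x
  have F: "finite {x. \<alpha> x \<noteq> 0}" using \<alpha> by (simp add: fsupp_def)
  have \<beta>: "\<beta> \<in> fsupp A"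
    by (auto simp: fsupp_def \<beta>_def intro: finite_subset[OF _ F])
  have restr: "pairing \<alpha> (\<lambda>x. if x \<in> A then g x else 0) = pairing \<beta> g" for g
  proof -
    have "pairing \<beta> g = (\<Sum>x\<in>{x. \<alpha> x \<noteq> 0}. \<beta> x * g x)"
      by (rule pairing_eq_sum[OF F]) (auto simp: \<beta>_def)
    then show ?thesis by (auto simp: pairing_def \<beta>_def intro!: sum.cong)
  qed
  have "form (\<lambda>(s, t). if s \<in> A \<and> t \<in> A then K (s, t) else 0) \<alpha> \<alpha>
      = pairing \<alpha> (\<lambda>s. if s \<in> A then pairing \<alpha> (\<lambda>t. if t \<in> A then K (s, t) else 0) else 0)"
    unfolding form_def by (intro arg_cong[where f = "pairing \<alpha>"]) auto
  also have "\<dots> = form K \<beta> \<beta>" unfolding restr form_def ..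
  also have "\<dots> \<ge> 0" by (rule covariance_form_nonneg[OF assms \<beta>])
  finally show "form (\<lambda>(s, t). if s \<in> A \<and> t \<in> A then K (s, t) else 0) \<alpha> \<alpha> \<ge> 0" .
qed (use assms in \<open>auto simp: covariance_on_def\<close>)

lemma quadratic_nonneg_discriminant:
  fixes a b c :: real
  assumes "\<And>x. a + 2 * x * b + x\<^sup>2 * c \<ge> 0" "c \<ge> 0"
  shows "b\<^sup>2 \<le> a * c"
proof (cases "c = 0")
  case True
  have "b = 0"
  proof (rule ccontr)
    assume "b \<noteq> 0"
    then show False using assms(1)[of "- (a + 1) / (2 * b)"] True by (simp add: field_simps)
  qed
  then show ?thesis using True by simp
next
  case False
  then have c: "c > 0" using assms(2) by simp
  have "a + 2 * (-b/c) * b + (-b/c)\<^sup>2 * c \<ge> 0" by (rule assms(1))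
  moreover have "a + 2 * (-b/c) * b + (-b/c)\<^sup>2 * c = a - b\<^sup>2 / c"
    using c by (simp add: power2_eq_square field_simps)
  ultimately have "b\<^sup>2 / c \<le> a" by linarith
  then show ?thesis using c by (simp add: field_simps)
qed

lemma form_Cauchy_Schwarz:
  assumes "covariance_on S K" "\<alpha> \<in> fsupp S" "\<beta> \<in> fsupp S"
  shows "(form K \<alpha> \<beta>)\<^sup>2 \<le> form K \<alpha> \<alpha> * form K \<beta> \<beta>"
proof (rule quadratic_nonneg_discriminant)
  fix x
  have "0 \<le> form K (\<lambda>y. 1 * \<alpha> y + x * \<beta> y) (\<lambda>y. 1 * \<alpha> y + x * \<beta> y)"
    by (intro covariance_form_nonneg[OF assms(1)] fsupp_lincomb assms)
  then show "0 \<le> form K \<alpha> \<alpha> + 2 * x * form K \<alpha> \<beta> + x\<^sup>2 * form K \<beta> \<beta>"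
    by (subst (asm) form_square[OF assms]) simp
qed (use assms covariance_form_nonneg in blast)

lemma covariance_Cauchy_Schwarz:
  assumes "covariance_on S K" "s \<in> S" "t \<in> S"
  shows "(K (s, t))\<^sup>2 \<le> K (s, s) * K (t, t)"
  using form_Cauchy_Schwarz[OF assms(1) delta_in_fsupp[OF assms(2)] delta_in_fsupp[OF assms(3)]]
  by simp

lemma covariance_diag_nonneg: "covariance_on S K \<Longrightarrow> s \<in> S \<Longrightarrow> K (s, s) \<ge> 0"
  using covariance_form_nonneg[of S K "delta s"] by (simp add: delta_in_fsupp)

text \<open>
  What is subtracted is the part of the covariance carried by the direction of \<open>k\<^sub>s\<close>, so
  Cauchy--Schwarz keeps the form nonnegative. If \<open>K (s, s) = 0\<close>, the quotients are \<open>0\<close> and nothing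
  is subtracted.
\<close>

lemma covariance_minus_rank_one:
  assumes cov: "covariance_on S K" and s: "s \<in> S"
  shows "covariance_on S (\<lambda>(x, y). K (x, y) - (K (s, x) / sqrt (K (s, s))) * (K (s, y) / sqrt (K (s, s))))"
  unfolding covariance_on_iff_form
proof (intro conjI ballI)
  fix \<alpha> assume \<alpha>: "\<alpha> \<in> fsupp S"
  let ?d = "sqrt (K (s, s))"
  define u where "u x = K (s, x) / ?d" for x
  have d: "K (s, s) \<ge> 0" by (rule covariance_diag_nonneg[OF cov s])
  have "form (\<lambda>(x, y). K (x, y) - (K (s, x) / ?d) * (K (s, y) / ?d)) \<alpha> \<alpha>
      = form K \<alpha> \<alpha> - (pairing \<alpha> u)\<^sup>2"
    using form_diff[of K "\<lambda>(x, y). u x * u y" \<alpha> \<alpha>] form_rank_one[of u u \<alpha> \<alpha>]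
    unfolding u_def by (simp add: power2_eq_square)
  moreover have "(pairing \<alpha> u)\<^sup>2 \<le> form K \<alpha> \<alpha>"
  proof (cases "K (s, s) = 0")
    case True
    then have "u = (\<lambda>x. 0)" by (auto simp: u_def)
    then show ?thesis using covariance_form_nonneg[OF cov \<alpha>] by simp
  next
    case False
    have "u = (\<lambda>x. 1 / ?d * K (s, x))" by (auto simp: u_def)
    then have "pairing \<alpha> u = pairing \<alpha> (\<lambda>x. K (s, x)) / ?d"
      using pairing_scale_right[of \<alpha> "1 / ?d" "\<lambda>x. K (s, x)"] by simp
    then have "(pairing \<alpha> u)\<^sup>2 = (pairing \<alpha> (\<lambda>x. K (s, x)))\<^sup>2 / K (s, s)"
      using d by (simp add: power_divide)
    moreover have "(pairing \<alpha> (\<lambda>x. K (s, x)))\<^sup>2 \<le> K (s, s) * form K \<alpha> \<alpha>"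
      using form_Cauchy_Schwarz[OF cov delta_in_fsupp[OF s] \<alpha>] by simp
    ultimately show ?thesis using d False by (simp add: divide_le_eq mult.commute)
  qed
  ultimately show "0 \<le> form (\<lambda>(x, y). K (x, y) - (K (s, x) / ?d) * (K (s, y) / ?d)) \<alpha> \<alpha>"
    by linarith
qed (use covariance_commute[OF cov] in auto)

section \<open>The norm of the reproducing kernel Hilbert space as a supremum\<close>

text \<open>
  Up to the constant \<open>\<parallel>f\<parallel>\<^sup>2\<close>, the gain is minus the squared distance from \<open>f\<close> to the
  combination with coefficients \<open>\<alpha>\<close>. Combinations are dense in the reproducing kernel
  Hilbert space, so the supremum of the gains is \<open>\<parallel>f\<parallel>\<^sup>2\<close>, and it is infinite exactly when \<open>f\<close>
  is not in the space. The inner product is recovered by polarization.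
\<close>

definition gain :: "('a \<times> 'a \<Rightarrow> real) \<Rightarrow> ('a \<Rightarrow> real) \<Rightarrow> ('a \<Rightarrow> real) \<Rightarrow> real" where
  "gain K f \<alpha> = 2 * pairing \<alpha> f - form K \<alpha> \<alpha>"

definition energy :: "'a set \<Rightarrow> ('a \<times> 'a \<Rightarrow> real) \<Rightarrow> ('a \<Rightarrow> real) \<Rightarrow> real" where
  "energy A K f = (SUP \<alpha>\<in>fsupp A. gain K f \<alpha>)"

definition finite_energy :: "'a set \<Rightarrow> ('a \<times> 'a \<Rightarrow> real) \<Rightarrow> ('a \<Rightarrow> real) \<Rightarrow> bool" where
  "finite_energy A K f \<longleftrightarrow> bdd_above (gain K f ` fsupp A)"

definition energy_inner ::
    "'a set \<Rightarrow> ('a \<times> 'a \<Rightarrow> real) \<Rightarrow> ('a \<Rightarrow> real) \<Rightarrow> ('a \<Rightarrow> real) \<Rightarrow> real" where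
  "energy_inner A K f g = (energy A K (\<lambda>x. f x + g x) - energy A K (\<lambda>x. f x - g x)) / 4"

lemma gain_zero [simp]: "gain K f (\<lambda>x. 0) = 0"
  by (simp add: gain_def)

lemma gain_cong:
  assumes "\<alpha> \<in> fsupp A" "\<And>x. x \<in> A \<Longrightarrow> f x = g x"
    "\<And>s t. s \<in> A \<Longrightarrow> t \<in> A \<Longrightarrow> K (s, t) = L (s, t)"
  shows "gain K f \<alpha> = gain L g \<alpha>"
  unfolding gain_def using pairing_cong[of \<alpha> A f g] form_cong[of \<alpha> A \<alpha> A K L] assms by simp

lemma energy_cong:
  assumes "\<And>x. x \<in> A \<Longrightarrow> f x = g x" "\<And>s t. s \<in> A \<Longrightarrow> t \<in> A \<Longrightarrow> K (s, t) = L (s, t)"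
  shows "energy A K f = energy A L g"
  unfolding energy_def using assms by (intro SUP_cong refl gain_cong[where A = A]) auto

lemma finite_energy_cong:
  assumes "\<And>x. x \<in> A \<Longrightarrow> f x = g x" "\<And>s t. s \<in> A \<Longrightarrow> t \<in> A \<Longrightarrow> K (s, t) = L (s, t)"
  shows "finite_energy A K f \<longleftrightarrow> finite_energy A L g"
proof -
  have "gain K f ` fsupp A = gain L g ` fsupp A"
    using assms by (intro image_cong refl gain_cong[where A = A]) auto
  then show ?thesis by (simp add: finite_energy_def)
qed

lemma energy_inner_cong:
  assumes "\<And>x. x \<in> A \<Longrightarrow> f x = f' x" "\<And>x. x \<in> A \<Longrightarrow> g x = g' x"
    "\<And>s t. s \<in> A \<Longrightarrow> t \<in> A \<Longrightarrow> K (s, t) = L (s, t)"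
  shows "energy_inner A K f g = energy_inner A L f' g'"
proof -
  have "energy A K (\<lambda>x. f x + g x) = energy A L (\<lambda>x. f' x + g' x)"
    "energy A K (\<lambda>x. f x - g x) = energy A L (\<lambda>x. f' x - g' x)"
    by (intro energy_cong; simp add: assms)+
  then show ?thesis by (simp add: energy_inner_def)
qed

lemma finite_energy_restrict [simp]:
  "finite_energy A K (restrict f A) \<longleftrightarrow> finite_energy A K f"
  by (intro finite_energy_cong) auto

lemma energy_inner_restrict [simp]:
  "energy_inner A K (restrict f A) g = energy_inner A K f g"
  "energy_inner A K f (restrict g A) = energy_inner A K f g"
  by (intro energy_inner_cong; simp)+

lemma gain_le_energy: "finite_energy A K f \<Longrightarrow> \<alpha> \<in> fsupp A \<Longrightarrow> gain K f \<alpha> \<le> energy A K f"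
  unfolding energy_def finite_energy_def by (intro cSUP_upper)

lemma energy_le: "(\<And>\<alpha>. \<alpha> \<in> fsupp A \<Longrightarrow> gain K f \<alpha> \<le> c) \<Longrightarrow> energy A K f \<le> c"
  unfolding energy_def using zero_in_fsupp by (intro cSUP_least) auto

lemma finite_energyI: "(\<And>\<alpha>. \<alpha> \<in> fsupp A \<Longrightarrow> gain K f \<alpha> \<le> c) \<Longrightarrow> finite_energy A K f"
  unfolding finite_energy_def by (intro bdd_aboveI2)

lemma energy_nonneg: "finite_energy A K f \<Longrightarrow> energy A K f \<ge> 0"
  using gain_le_energy[OF _ zero_in_fsupp, of A K f] by simp

lemma gain_near_energy:
  assumes "e > 0"
  obtains \<alpha> where "\<alpha> \<in> fsupp A" "gain K f \<alpha> > energy A K f - e"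
proof -
  have "\<exists>\<alpha>\<in>fsupp A. gain K f \<alpha> > energy A K f - e"
  proof (rule ccontr)
    assume "\<not> ?thesis"
    then have "energy A K f \<le> energy A K f - e" by (intro energy_le) (auto simp: not_less)
    then show False using assms by simp
  qed
  then show ?thesis using that by blast
qed

text \<open>
  The parallelogram law makes the polarized inner product additive and bounds its growth
  quadratically; this turns additivity into real homogeneity.
\<close>

lemma additive_quadratically_bounded_imp_linear:
  fixes \<phi> :: "real \<Rightarrow> real"
  assumes add: "\<And>a b. \<phi> (a + b) = \<phi> a + \<phi> b" and bound: "\<And>c. \<bar>\<phi> c\<bar> \<le> M * c\<^sup>2 + N"
    and "M \<ge> 0"
  shows "\<phi> c = c * \<phi> 1"
proof -
  \<comment> \<open>The deviation from linearity is additive and 1-periodic. Being bounded on the unit interval, it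
    is bounded, and an additive bounded function is zero.\<close>
  define \<psi> where "\<psi> c = \<phi> c - c * \<phi> 1" for c
  have \<psi>_add: "\<psi> (a + b) = \<psi> a + \<psi> b" for a b by (simp add: \<psi>_def add algebra_simps)
  have \<psi>0: "\<psi> 0 = 0" using \<psi>_add[of 0 0] by simp
  have \<psi>_neg: "\<psi> (- a) = - \<psi> a" for a using \<psi>_add[of a "-a"] \<psi>0 by simp
  have \<psi>_mult: "\<psi> (real n * a) = real n * \<psi> a" for n a
    by (induction n) (simp_all add: \<psi>0 \<psi>_add distrib_right)
  have \<psi>_nat: "\<psi> (real n) = 0" for n
    using \<psi>_mult[of n 1] by (simp add: \<psi>_def)
  define B where "B = M + N + \<bar>\<phi> 1\<bar>"
  have bounded: "\<bar>\<psi> a\<bar> \<le> B" if "a \<ge> 0" for a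
  proof -
    define k y where "k = nat \<lfloor>a\<rfloor>" and "y = a - real k"
    have y: "0 \<le> y" "y \<le> 1" using that by (auto simp: y_def k_def) linarith
    have "\<psi> a = \<psi> y" using \<psi>_add[of y "real k"] \<psi>_nat[of k] by (simp add: y_def)
    moreover have "\<bar>\<phi> y\<bar> \<le> M + N"
    proof -
      have "y\<^sup>2 \<le> 1" using y by (simp add: power_le_one)
      then have "M * y\<^sup>2 \<le> M" using \<open>M \<ge> 0\<close> mult_left_mono[of "y\<^sup>2" 1 M] by simp
      then show ?thesis using bound[of y] by linarith
    qed
    moreover have "\<bar>y * \<phi> 1\<bar> \<le> \<bar>\<phi> 1\<bar>"
      using y mult_right_mono[of y 1 "\<bar>\<phi> 1\<bar>"] by (simp add: abs_mult)
    ultimately show ?thesis unfolding B_def \<psi>_def by linarith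
  qed
  have zero: "\<psi> a = 0" if "a \<ge> 0" for a
  proof (rule ccontr)
    assume "\<psi> a \<noteq> 0"
    then obtain n :: nat where "real n * \<bar>\<psi> a\<bar> > B"
      using reals_Archimedean3[of "\<bar>\<psi> a\<bar>"] by auto
    moreover have "\<bar>\<psi> (real n * a)\<bar> \<le> B" using that by (intro bounded) simp
    ultimately show False by (simp add: \<psi>_mult abs_mult)
  qed
  have "\<psi> c = 0" using zero[of c] zero[of "-c"] \<psi>_neg[of c] by (cases "c \<ge> 0") auto
  then show ?thesis by (simp add: \<psi>_def)
qed

context
  fixes A :: "'a set" and K :: "'a \<times> 'a \<Rightarrow> real"
  assumes cov: "covariance_on A K"
begin

text \<open>
  The parallelogram law for the energy comes from this identity for gains, that is from passing
  to half the sum and half the difference of the coefficients.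
\<close>

lemma gain_parallelogram:
  assumes "\<alpha> \<in> fsupp A" "\<beta> \<in> fsupp A"
  shows "gain K (\<lambda>x. f x + g x) \<alpha> + gain K (\<lambda>x. f x - g x) \<beta>
    = 2 * gain K f (\<lambda>x. 1/2 * \<alpha> x + 1/2 * \<beta> x) + 2 * gain K g (\<lambda>x. 1/2 * \<alpha> x + (-1/2) * \<beta> x)"
  unfolding gain_def form_square[OF cov assms] pairing_lincomb_left[OF assms]
    pairing_add_right pairing_diff_right by (simp add: field_simps power2_eq_square)

lemma energy_sum_diff_le:
  assumes f: "finite_energy A K f" and g: "finite_energy A K g"
  shows "finite_energy A K (\<lambda>x. f x + g x)" "finite_energy A K (\<lambda>x. f x - g x)"
    "energy A K (\<lambda>x. f x + g x) + energy A K (\<lambda>x. f x - g x) \<le> 2 * energy A K f + 2 * energy A K g"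
proof -
  let ?M = "2 * energy A K f + 2 * energy A K g"
  have le: "gain K (\<lambda>x. f x + g x) \<alpha> + gain K (\<lambda>x. f x - g x) \<beta> \<le> ?M"
    if "\<alpha> \<in> fsupp A" "\<beta> \<in> fsupp A" for \<alpha> \<beta>
    unfolding gain_parallelogram[OF that]
    using gain_le_energy[OF f fsupp_lincomb[OF that], of "1/2" "1/2"]
      gain_le_energy[OF g fsupp_lincomb[OF that], of "1/2" "-1/2"] by linarith
  show "finite_energy A K (\<lambda>x. f x + g x)"
    using le[OF _ zero_in_fsupp] by (intro finite_energyI[where c = ?M]) simp
  show "finite_energy A K (\<lambda>x. f x - g x)"
    using le[OF zero_in_fsupp] by (intro finite_energyI[where c = ?M]) simp
  have "energy A K (\<lambda>x. f x + g x) \<le> ?M - energy A K (\<lambda>x. f x - g x)"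
  proof (rule energy_le)
    fix \<alpha> assume \<alpha>: "\<alpha> \<in> fsupp A"
    have "energy A K (\<lambda>x. f x - g x) \<le> ?M - gain K (\<lambda>x. f x + g x) \<alpha>"
      using le[OF \<alpha>] by (intro energy_le) (simp add: algebra_simps)
    then show "gain K (\<lambda>x. f x + g x) \<alpha> \<le> ?M - energy A K (\<lambda>x. f x - g x)" by simp
  qed
  then show "energy A K (\<lambda>x. f x + g x) + energy A K (\<lambda>x. f x - g x) \<le> ?M" by simp
qed

lemma gain_scale_le:
  assumes f: "finite_energy A K f" and \<alpha>: "\<alpha> \<in> fsupp A"
  shows "gain K (\<lambda>x. c * f x) \<alpha> \<le> c\<^sup>2 * energy A K f"
proof (cases "c = 0")
  case True
  then show ?thesis using covariance_form_nonneg[OF cov \<alpha>] by (simp add: gain_def)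
next
  case False
  have "gain K (\<lambda>x. c * f x) \<alpha> = c\<^sup>2 * gain K f (\<lambda>x. (1/c) * \<alpha> x + 0 * \<alpha> x)"
    unfolding gain_def form_square[OF cov \<alpha> \<alpha>] pairing_lincomb_left[OF \<alpha> \<alpha>] pairing_scale_right
    using False by (simp add: field_simps power2_eq_square)
  also have "\<dots> \<le> c\<^sup>2 * energy A K f"
    by (intro mult_left_mono gain_le_energy[OF f] fsupp_lincomb \<alpha>) simp
  finally show ?thesis .
qed

lemma finite_energy_scale: "finite_energy A K f \<Longrightarrow> finite_energy A K (\<lambda>x. c * f x)"
  by (rule finite_energyI, rule gain_scale_le)

lemma energy_zero [simp]: "energy A K (\<lambda>x. 0) = 0" and finite_energy_zero: "finite_energy A K (\<lambda>x. 0)"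
proof -
  have le: "gain K (\<lambda>x. 0) \<alpha> \<le> 0" if "\<alpha> \<in> fsupp A" for \<alpha>
    using covariance_form_nonneg[OF cov that] by (simp add: gain_def)
  then show fin: "finite_energy A K (\<lambda>x. 0)" by (rule finite_energyI)
  show "energy A K (\<lambda>x. 0) = 0"
    using energy_le[of A K "\<lambda>x. 0" 0] le energy_nonneg[OF fin] by (simp add: antisym)
qed

lemma energy_scale:
  assumes f: "finite_energy A K f"
  shows "energy A K (\<lambda>x. c * f x) = c\<^sup>2 * energy A K f"
proof (cases "c = 0")
  case False
  have le: "energy A K (\<lambda>x. c * f x) \<le> c\<^sup>2 * energy A K f"
    by (rule energy_le, rule gain_scale_le[OF f])
  have "energy A K (\<lambda>x. (1/c) * (c * f x)) \<le> (1/c)\<^sup>2 * energy A K (\<lambda>x. c * f x)"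
    by (rule energy_le, rule gain_scale_le[OF finite_energy_scale[OF f]])
  moreover have "(\<lambda>x. (1/c) * (c * f x)) = f" using False by auto
  ultimately have "c\<^sup>2 * energy A K f \<le> energy A K (\<lambda>x. c * f x)"
    using False by (simp add: field_simps)
  with le show ?thesis by simp
qed simp

lemma energy_parallelogram:
  assumes f: "finite_energy A K f" and g: "finite_energy A K g"
  shows "energy A K (\<lambda>x. f x + g x) + energy A K (\<lambda>x. f x - g x) = 2 * energy A K f + 2 * energy A K g"
proof -
  note fg = energy_sum_diff_le[OF f g]
  have "(\<lambda>x. f x + g x + (f x - g x)) = (\<lambda>x. 2 * f x)"
    "(\<lambda>x. f x + g x - (f x - g x)) = (\<lambda>x. 2 * g x)" by auto
  then have "4 * energy A K f + 4 * energy A K g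
      \<le> 2 * energy A K (\<lambda>x. f x + g x) + 2 * energy A K (\<lambda>x. f x - g x)"
    using energy_sum_diff_le(3)[OF fg(1,2)] by (simp add: energy_scale f g)
  then show ?thesis using fg(3) by simp
qed

lemma finite_energy_add:
    "finite_energy A K f \<Longrightarrow> finite_energy A K g \<Longrightarrow> finite_energy A K (\<lambda>x. f x + g x)"
  and finite_energy_diff:
    "finite_energy A K f \<Longrightarrow> finite_energy A K g \<Longrightarrow> finite_energy A K (\<lambda>x. f x - g x)"
  by (fact energy_sum_diff_le)+

lemma energy_inner_self:
  assumes "finite_energy A K f"
  shows "energy_inner A K f f = energy A K f"
proof -
  have "(\<lambda>x. f x + f x) = (\<lambda>x. 2 * f x)" by auto
  then show ?thesis using energy_scale[OF assms, of 2] by (simp add: energy_inner_def)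
qed

lemma energy_inner_commute:
  assumes f: "finite_energy A K f" and g: "finite_energy A K g"
  shows "energy_inner A K f g = energy_inner A K g f"
  using energy_scale[OF finite_energy_diff[OF f g], of "-1"]
  by (simp add: energy_inner_def add.commute)

text \<open>
  Expresses the inner product by energies at \<open>f \<plusminus> 2 h\<close>. For \<open>f + g\<close> in place of \<open>f\<close> these are the
  arguments that appear when the parallelogram law is applied to \<open>f + h, g + h\<close> and to
  \<open>f - h, g - h\<close>, whence additivity.
\<close>

lemma energy_inner_double:
  assumes f: "finite_energy A K f" and h: "finite_energy A K h"
  shows "energy A K (\<lambda>x. f x + 2 * h x) - energy A K (\<lambda>x. f x - 2 * h x) = 8 * energy_inner A K f h"
proof -
  have "energy A K (\<lambda>x. f x + h x + h x) + energy A K (\<lambda>x. f x + h x - h x)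
      = 2 * energy A K (\<lambda>x. f x + h x) + 2 * energy A K h"
    by (intro energy_parallelogram finite_energy_add f h)
  moreover have "energy A K (\<lambda>x. f x - h x + h x) + energy A K (\<lambda>x. f x - h x - h x)
      = 2 * energy A K (\<lambda>x. f x - h x) + 2 * energy A K h"
    by (intro energy_parallelogram finite_energy_diff f h)
  moreover have "(\<lambda>x. f x + h x + h x) = (\<lambda>x. f x + 2 * h x)"
    "(\<lambda>x. f x - h x - h x) = (\<lambda>x. f x - 2 * h x)" by auto
  ultimately show ?thesis by (simp add: energy_inner_def)
qed

lemma energy_inner_add:
  assumes f: "finite_energy A K f" and g: "finite_energy A K g" and h: "finite_energy A K h"
  shows "energy_inner A K (\<lambda>x. f x + g x) h = energy_inner A K f h + energy_inner A K g h"
proof -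
  have sums: "(\<lambda>x. (f x + h x) + (g x + h x)) = (\<lambda>x. (f x + g x) + 2 * h x)"
    "(\<lambda>x. (f x - h x) + (g x - h x)) = (\<lambda>x. (f x + g x) - 2 * h x)"
    "(\<lambda>x. (f x + h x) - (g x + h x)) = (\<lambda>x. f x - g x)"
    "(\<lambda>x. (f x - h x) - (g x - h x)) = (\<lambda>x. f x - g x)" by auto
  have "energy A K (\<lambda>x. f x + g x + 2 * h x) + energy A K (\<lambda>x. f x - g x)
      = 2 * energy A K (\<lambda>x. f x + h x) + 2 * energy A K (\<lambda>x. g x + h x)"
    using energy_parallelogram[OF finite_energy_add[OF f h] finite_energy_add[OF g h]]
    unfolding sums .
  moreover have "energy A K (\<lambda>x. f x + g x - 2 * h x) + energy A K (\<lambda>x. f x - g x)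
      = 2 * energy A K (\<lambda>x. f x - h x) + 2 * energy A K (\<lambda>x. g x - h x)"
    using energy_parallelogram[OF finite_energy_diff[OF f h] finite_energy_diff[OF g h]]
    unfolding sums .
  moreover have "4 * energy_inner A K f h = energy A K (\<lambda>x. f x + h x) - energy A K (\<lambda>x. f x - h x)"
    "4 * energy_inner A K g h = energy A K (\<lambda>x. g x + h x) - energy A K (\<lambda>x. g x - h x)"
    by (simp_all add: energy_inner_def)
  ultimately show ?thesis
    using energy_inner_double[OF finite_energy_add[OF f g] h] by linarith
qed

lemma energy_inner_scale:
  assumes f: "finite_energy A K f" and g: "finite_energy A K g"
  shows "energy_inner A K (\<lambda>x. c * f x) g = c * energy_inner A K f g"
proof -
  define \<phi> where "\<phi> c = energy_inner A K (\<lambda>x. c * f x) g" for c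
  have "\<phi> c = c * \<phi> 1"
  proof (rule additive_quadratically_bounded_imp_linear)
    show "\<phi> (a + b) = \<phi> a + \<phi> b" for a b
      using energy_inner_add[OF finite_energy_scale[OF f, of a] finite_energy_scale[OF f, of b] g]
      by (simp add: \<phi>_def distrib_right)
    show "\<bar>\<phi> c\<bar> \<le> (energy A K f / 2) * c\<^sup>2 + energy A K g / 2" for c
    proof -
      note cf = finite_energy_scale[OF f, of c]
      have "\<bar>4 * \<phi> c\<bar> \<le> energy A K (\<lambda>x. c * f x + g x) + energy A K (\<lambda>x. c * f x - g x)"
        using energy_nonneg[OF finite_energy_add[OF cf g]] energy_nonneg[OF finite_energy_diff[OF cf g]]
        by (simp add: \<phi>_def energy_inner_def)
      then show ?thesis using energy_parallelogram[OF cf g] by (simp add: energy_scale[OF f] abs_mult mult.commute)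
    qed
    show "energy A K f / 2 \<ge> 0" using energy_nonneg[OF f] by simp
  qed
  then show ?thesis by (simp add: \<phi>_def)
qed

text \<open>
  Adding a multiple of \<open>K(s,\<cdot>)\<close> to \<open>f\<close> translates the coefficients over which the supremum is
  taken. The energy therefore changes by an explicit quadratic polynomial, whose linear term is the
  reproducing property.
\<close>

lemma gain_add_kernel:
  assumes s: "s \<in> A" and \<alpha>: "\<alpha> \<in> fsupp A"
  shows "gain K (\<lambda>x. f x + c * K (s, x)) \<alpha>
    = gain K f (\<lambda>x. 1 * \<alpha> x + (- c) * delta s x) + 2 * c * f s + c\<^sup>2 * K (s, s)"
proof -
  have "form K \<alpha> (delta s) = pairing \<alpha> (\<lambda>x. K (s, x))"
    using form_commute[OF cov \<alpha> delta_in_fsupp[OF s]] by simp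
  then show ?thesis
    unfolding gain_def form_square[OF cov \<alpha> delta_in_fsupp[OF s]]
      pairing_lincomb_left[OF \<alpha> delta_in_fsupp[OF s]] pairing_add_right pairing_scale_right
    by (simp add: algebra_simps power2_eq_square)
qed

lemma gain_add_kernel_le:
  assumes f: "finite_energy A K f" and s: "s \<in> A" and \<alpha>: "\<alpha> \<in> fsupp A"
  shows "gain K (\<lambda>x. f x + c * K (s, x)) \<alpha> \<le> energy A K f + 2 * c * f s + c\<^sup>2 * K (s, s)"
  unfolding gain_add_kernel[OF s \<alpha>]
  using gain_le_energy[OF f fsupp_lincomb[OF \<alpha> delta_in_fsupp[OF s]], of 1 "-c"] by linarith

lemma finite_energy_add_kernel:
    "finite_energy A K f \<Longrightarrow> s \<in> A \<Longrightarrow> finite_energy A K (\<lambda>x. f x + c * K (s, x))"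
  by (rule finite_energyI, rule gain_add_kernel_le)

lemma energy_add_kernel:
  assumes f: "finite_energy A K f" and s: "s \<in> A"
  shows "energy A K (\<lambda>x. f x + c * K (s, x)) = energy A K f + 2 * c * f s + c\<^sup>2 * K (s, s)"
proof (rule antisym)
  show "energy A K (\<lambda>x. f x + c * K (s, x)) \<le> energy A K f + 2 * c * f s + c\<^sup>2 * K (s, s)"
    by (rule energy_le, rule gain_add_kernel_le[OF f s])
  define h where "h x = f x + c * K (s, x)" for x
  have "energy A K (\<lambda>x. h x + (- c) * K (s, x)) \<le> energy A K h + 2 * (- c) * h s + (- c)\<^sup>2 * K (s, s)"
    using finite_energy_add_kernel[OF f s]
    by (intro energy_le gain_add_kernel_le s) (simp add: h_def[abs_def])
  then show "energy A K f + 2 * c * f s + c\<^sup>2 * K (s, s) \<le> energy A K (\<lambda>x. f x + c * K (s, x))"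
    by (simp add: h_def[abs_def] power2_eq_square algebra_simps)
qed

lemma finite_energy_kernel: "s \<in> A \<Longrightarrow> finite_energy A K (\<lambda>x. K (s, x))"
  using finite_energy_add_kernel[OF finite_energy_zero, of s 1] by simp

lemma energy_inner_reproducing:
  assumes "finite_energy A K f" "s \<in> A"
  shows "energy_inner A K f (\<lambda>x. K (s, x)) = f s"
  using energy_add_kernel[OF assms, of 1] energy_add_kernel[OF assms, of "-1"]
  by (simp add: energy_inner_def)

lemma evaluation_bound:
  assumes f: "finite_energy A K f" and s: "s \<in> A"
  shows "(f s)\<^sup>2 \<le> energy A K f * K (s, s)"
proof (rule quadratic_nonneg_discriminant)
  show "0 \<le> energy A K f + 2 * c * f s + c\<^sup>2 * K (s, s)" for c
    using energy_nonneg[OF finite_energy_add_kernel[OF f s], of c] unfolding energy_add_kernel[OF f s] .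
qed (rule covariance_diag_nonneg[OF cov s])

end

section \<open>Existence and uniqueness of the reproducing kernel Hilbert space\<close>

definition kernel_space :: "'a set \<Rightarrow> ('a \<times> 'a \<Rightarrow> real) \<Rightarrow> ('a \<Rightarrow> real) set" where
  "kernel_space A K = {f \<in> extensional A. finite_energy A K f}"

lemma pairing_tendsto:
  assumes "\<alpha> \<in> fsupp A" "\<And>x. x \<in> A \<Longrightarrow> (\<lambda>n. F n x) \<longlonglongrightarrow> f x"
  shows "(\<lambda>n. pairing \<alpha> (F n)) \<longlonglongrightarrow> pairing \<alpha> f"
  unfolding pairing_def using assms by (intro tendsto_intros) (auto simp: fsupp_def)

lemma gain_le_if_tendsto:
  assumes \<alpha>: "\<alpha> \<in> fsupp A" and lim: "\<And>x. x \<in> A \<Longrightarrow> (\<lambda>n. F n x) \<longlonglongrightarrow> f x"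
    and le: "\<And>n. n \<ge> N \<Longrightarrow> finite_energy A K (F n) \<and> energy A K (F n) \<le> c"
  shows "gain K f \<alpha> \<le> c"
proof (rule LIMSEQ_le_const2)
  show "(\<lambda>n. gain K (F n) \<alpha>) \<longlonglongrightarrow> gain K f \<alpha>"
    unfolding gain_def by (intro tendsto_intros pairing_tendsto[OF \<alpha>] lim)
  show "\<exists>N. \<forall>n\<ge>N. gain K (F n) \<alpha> \<le> c"
    using le gain_le_energy[OF _ \<alpha>] order_trans by blast
qed

text \<open>
  Point evaluations are bounded, so a Cauchy sequence converges pointwise. Each gain involves
  only finitely many values, so the energy is lower semicontinuous under pointwise limits and
  the convergence holds in norm as well.
\<close>

lemma kernel_space_complete:
  assumes cov: "covariance_on A K"
    and F: "\<And>n. finite_energy A K (F n)"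
    and Cauchy: "\<And>e. e > 0 \<Longrightarrow> \<exists>N. \<forall>i\<ge>N. \<forall>j\<ge>N. sqrt (energy A K (\<lambda>x. F i x - F j x)) < e"
  obtains f where "finite_energy A K f" "(\<lambda>n. sqrt (energy A K (\<lambda>x. F n x - f x))) \<longlonglongrightarrow> 0"
proof -
  define f where "f s = lim (\<lambda>n. F n s)" for s
  have lim: "(\<lambda>n. F n s) \<longlonglongrightarrow> f s" if s: "s \<in> A" for s
  proof -
    define d where "d = sqrt (K (s, s)) + 1"
    have d: "d > 0" "sqrt (K (s, s)) \<le> d"
      using covariance_diag_nonneg[OF cov s] by (auto simp: d_def add_nonneg_pos)
    have bound: "\<bar>F i s - F j s\<bar> \<le> sqrt (energy A K (\<lambda>x. F i x - F j x)) * d" for i j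
    proof -
      have fin: "finite_energy A K (\<lambda>x. F i x - F j x)" by (intro finite_energy_diff[OF cov] F)
      have "\<bar>F i s - F j s\<bar> = sqrt ((F i s - F j s)\<^sup>2)" by simp
      also have "\<dots> \<le> sqrt (energy A K (\<lambda>x. F i x - F j x) * K (s, s))"
        using evaluation_bound[OF cov fin s] by (intro real_sqrt_le_mono) simp
      also have "\<dots> \<le> sqrt (energy A K (\<lambda>x. F i x - F j x)) * d"
        unfolding real_sqrt_mult using energy_nonneg[OF fin] d by (intro mult_left_mono) auto
      finally show ?thesis .
    qed
    have "Cauchy (\<lambda>n. F n s)"
    proof (rule metric_CauchyI)
      fix e :: real assume "e > 0"
      then have "e / d > 0" using d by simp
      from Cauchy[OF this] obtain N where
        N: "\<And>i j. i \<ge> N \<Longrightarrow> j \<ge> N \<Longrightarrow> sqrt (energy A K (\<lambda>x. F i x - F j x)) < e / d" by blast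
      have "dist (F i s) (F j s) < e" if "i \<ge> N" "j \<ge> N" for i j
        using bound[of i j] N[OF that] d by (simp add: dist_real_def pos_less_divide_eq)
      then show "\<exists>N. \<forall>i\<ge>N. \<forall>j\<ge>N. dist (F i s) (F j s) < e" by blast
    qed
    then show ?thesis unfolding f_def by (simp add: Cauchy_convergent_iff convergent_LIMSEQ_iff)
  qed
  have close: "\<exists>N. \<forall>n\<ge>N. finite_energy A K (\<lambda>x. F n x - f x) \<and> energy A K (\<lambda>x. F n x - f x) \<le> e\<^sup>2"
    if "e > 0" for e :: real
  proof -
    from Cauchy[OF that] obtain N where
      N: "\<And>i j. i \<ge> N \<Longrightarrow> j \<ge> N \<Longrightarrow> sqrt (energy A K (\<lambda>x. F i x - F j x)) < e" by blast
    have le: "gain K (\<lambda>x. F n x - f x) \<alpha> \<le> e\<^sup>2" if n: "n \<ge> N" and \<alpha>: "\<alpha> \<in> fsupp A" for n \<alpha>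
    proof (rule gain_le_if_tendsto[OF \<alpha>, where F = "\<lambda>m x. F n x - F m x" and N = N])
      show "(\<lambda>m. F n x - F m x) \<longlonglongrightarrow> F n x - f x" if "x \<in> A" for x
        by (intro tendsto_intros lim that)
      fix m assume m: "m \<ge> N"
      have fin: "finite_energy A K (\<lambda>x. F n x - F m x)" by (intro finite_energy_diff[OF cov] F)
      have "(sqrt (energy A K (\<lambda>x. F n x - F m x)))\<^sup>2 \<le> e\<^sup>2"
        using N[OF n m] energy_nonneg[OF fin] by (intro power_mono) auto
      then show "finite_energy A K (\<lambda>x. F n x - F m x) \<and> energy A K (\<lambda>x. F n x - F m x) \<le> e\<^sup>2"
        using fin energy_nonneg[OF fin] by simp
    qed
    have "finite_energy A K (\<lambda>x. F n x - f x) \<and> energy A K (\<lambda>x. F n x - f x) \<le> e\<^sup>2" if "n \<ge> N" for n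
      using finite_energyI[OF le[OF that]] energy_le[OF le[OF that]] by blast
    then show ?thesis by blast
  qed
  obtain N where N: "finite_energy A K (\<lambda>x. F N x - f x)" using close[of 1] by auto
  have "f = (\<lambda>x. F N x - (F N x - f x))" by simp
  then have fin: "finite_energy A K f" using finite_energy_diff[OF cov F N] by metis
  have "(\<lambda>n. sqrt (energy A K (\<lambda>x. F n x - f x))) \<longlonglongrightarrow> 0"
  proof (rule LIMSEQ_I)
    fix e :: real assume e: "e > 0"
    from close[of "e/2"] e obtain N where
      N: "\<And>n. n \<ge> N \<Longrightarrow> energy A K (\<lambda>x. F n x - f x) \<le> (e/2)\<^sup>2" by auto
    have "norm (sqrt (energy A K (\<lambda>x. F n x - f x)) - 0) < e" if "n \<ge> N" for n
    proof -
      have "sqrt (energy A K (\<lambda>x. F n x - f x)) \<le> sqrt ((e/2)\<^sup>2)"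
        using N[OF that] by (rule real_sqrt_le_mono)
      also have "\<dots> < e" using e by simp
      finally show ?thesis using energy_nonneg[OF finite_energy_diff[OF cov F fin]] by simp
    qed
    then show "\<exists>N. \<forall>n\<ge>N. norm (sqrt (energy A K (\<lambda>x. F n x - f x)) - 0) < e" by blast
  qed
  with fin show ?thesis by (rule that)
qed

theorem rkhs_kernel_space:
  assumes cov: "covariance_on A K"
  shows "rkhs A K (kernel_space A K) (energy_inner A K)"
proof unfold_locales
  let ?H = "kernel_space A K"
  show "?H \<subseteq> extensional A" by (auto simp: kernel_space_def)
  show "(\<lambda>x\<in>A. 0) \<in> ?H" by (simp add: kernel_space_def finite_energy_zero[OF cov])
  show "(\<lambda>x\<in>A. f x + g x) \<in> ?H" if "f \<in> ?H" "g \<in> ?H" for f g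
    using that by (simp add: kernel_space_def finite_energy_add[OF cov])
  show "(\<lambda>x\<in>A. c * f x) \<in> ?H" if "f \<in> ?H" for f c
    using that by (simp add: kernel_space_def finite_energy_scale[OF cov])
  show "energy_inner A K f g = energy_inner A K g f" if "f \<in> ?H" "g \<in> ?H" for f g
    using that by (simp add: kernel_space_def energy_inner_commute[OF cov])
  show "energy_inner A K (\<lambda>x\<in>A. f x + g x) h = energy_inner A K f h + energy_inner A K g h"
    if "f \<in> ?H" "g \<in> ?H" "h \<in> ?H" for f g h
    using that by (simp add: kernel_space_def energy_inner_add[OF cov])
  show "energy_inner A K (\<lambda>x\<in>A. c * f x) g = c * energy_inner A K f g"
    if "f \<in> ?H" "g \<in> ?H" for f g c
    using that by (simp add: kernel_space_def energy_inner_scale[OF cov])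
  show "energy_inner A K f f \<ge> 0" if "f \<in> ?H" for f
    using that by (simp add: kernel_space_def energy_inner_self[OF cov] energy_nonneg)
  show "f = (\<lambda>x\<in>A. 0)" if f: "f \<in> ?H" and 0: "energy_inner A K f f = 0" for f
  proof
    fix x
    have fin: "finite_energy A K f" "f \<in> extensional A" using f by (auto simp: kernel_space_def)
    have "energy A K f = 0" using 0 by (simp add: energy_inner_self[OF cov fin(1)])
    then show "f x = (\<lambda>x\<in>A. 0) x"
      using evaluation_bound[OF cov fin(1), of x] fin(2) by (cases "x \<in> A") (auto simp: extensional_def)
  qed
  show "\<exists>f\<in>?H. (\<lambda>n. sqrt (energy_inner A K (\<lambda>x\<in>A. F n x - f x) (\<lambda>x\<in>A. F n x - f x))) \<longlonglongrightarrow> 0"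
    if range: "range F \<subseteq> ?H" and Cauchy: "\<And>e. e > 0 \<Longrightarrow> \<exists>N. \<forall>i\<ge>N. \<forall>j\<ge>N.
      sqrt (energy_inner A K (\<lambda>x\<in>A. F i x - F j x) (\<lambda>x\<in>A. F i x - F j x)) < e" for F :: "nat \<Rightarrow> 'a \<Rightarrow> real"
  proof -
    have F: "finite_energy A K (F n)" for n using range by (auto simp: kernel_space_def)
    have cauchy: "\<exists>N. \<forall>i\<ge>N. \<forall>j\<ge>N. sqrt (energy A K (\<lambda>x. F i x - F j x)) < e" if "e > 0" for e
      using Cauchy[OF that] by (simp add: energy_inner_self[OF cov finite_energy_diff[OF cov F F]])
    obtain f where f: "finite_energy A K f"
        and lim: "(\<lambda>n. sqrt (energy A K (\<lambda>x. F n x - f x))) \<longlonglongrightarrow> 0"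
      by (rule kernel_space_complete[OF cov F cauchy])
    have "energy_inner A K (\<lambda>x\<in>A. F n x - restrict f A x) (\<lambda>x\<in>A. F n x - restrict f A x)
        = energy A K (\<lambda>x. F n x - f x)" for n
      unfolding energy_inner_self[OF cov finite_energy_diff[OF cov F f], symmetric]
      by (intro energy_inner_cong) auto
    then show ?thesis
      using f lim by (intro bexI[of _ "restrict f A"]) (auto simp: kernel_space_def)
  qed
  show "(\<lambda>x\<in>A. K (s, x)) \<in> ?H" if "s \<in> A" for s
    using that by (simp add: kernel_space_def finite_energy_kernel[OF cov])
  show "energy_inner A K f (\<lambda>x\<in>A. K (s, x)) = f s" if "f \<in> ?H" "s \<in> A" for f s
    using that by (simp add: kernel_space_def energy_inner_reproducing[OF cov])
qed

context function_hilbert_space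
begin

lemma diff: "f \<in> H \<Longrightarrow> g \<in> H \<Longrightarrow> (\<lambda>x\<in>A. f x - g x) \<in> H"
proof -
  assume f: "f \<in> H" and g: "g \<in> H"
  have "(\<lambda>x\<in>A. f x + (\<lambda>x\<in>A. (-1) * g x) x) \<in> H" by (intro add scale f g)
  moreover have "(\<lambda>x\<in>A. f x + (\<lambda>x\<in>A. (-1) * g x) x) = (\<lambda>x\<in>A. f x - g x)" by auto
  ultimately show ?thesis by simp
qed

lemma ip_diff:
  assumes f: "f \<in> H" and g: "g \<in> H" and h: "h \<in> H"
  shows "ip (\<lambda>x\<in>A. f x - g x) h = ip f h - ip g h"
proof -
  have eq: "(\<lambda>x\<in>A. f x - g x) = (\<lambda>x\<in>A. f x + (\<lambda>x\<in>A. (-1) * g x) x)" by (rule restrict_ext) simp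
  have "ip (\<lambda>x\<in>A. f x - g x) h = ip f h + ip (\<lambda>x\<in>A. (-1) * g x) h"
    unfolding eq by (intro ip_add f scale g h)
  moreover have "ip (\<lambda>x\<in>A. (-1) * g x) h = -1 * ip g h" by (intro ip_scale g h)
  ultimately show ?thesis by linarith
qed

lemma ip_diff_self:
  assumes f: "f \<in> H" and g: "g \<in> H"
  shows "ip (\<lambda>x\<in>A. f x - g x) (\<lambda>x\<in>A. f x - g x) = ip f f - 2 * ip f g + ip g g"
  using ip_diff[OF f g diff[OF f g]] ip_diff[OF f g f] ip_diff[OF f g g]
    ip_commute[OF f diff[OF f g]] ip_commute[OF g diff[OF f g]] ip_commute[OF f g] by simp

lemma ip_add_self:
  assumes f: "f \<in> H" and g: "g \<in> H"
  shows "ip (\<lambda>x\<in>A. f x + g x) (\<lambda>x\<in>A. f x + g x) = ip f f + 2 * ip f g + ip g g"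
  using ip_add[OF f g add[OF f g]] ip_add[OF f g f] ip_add[OF f g g]
    ip_commute[OF f add[OF f g]] ip_commute[OF g add[OF f g]] ip_commute[OF f g] by simp

lemma ip_Cauchy_Schwarz:
  assumes f: "f \<in> H" and g: "g \<in> H"
  shows "(ip f g)\<^sup>2 \<le> ip f f * ip g g"
proof (rule quadratic_nonneg_discriminant)
  fix c
  have cg: "(\<lambda>x\<in>A. c * g x) \<in> H" by (rule scale[OF g])
  have "ip f (\<lambda>x\<in>A. c * g x) = c * ip f g"
    using ip_scale[OF g f, of c] ip_commute[OF f cg] ip_commute[OF f g] by simp
  moreover have "ip (\<lambda>x\<in>A. c * g x) (\<lambda>x\<in>A. c * g x) = c\<^sup>2 * ip g g"
    using ip_scale[OF g cg, of c] ip_scale[OF g g, of c] ip_commute[OF g cg]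
    by (simp add: power2_eq_square)
  ultimately show "0 \<le> ip f f + 2 * c * ip f g + c\<^sup>2 * ip g g"
    using ip_nonneg[OF add[OF f cg]] ip_add_self[OF f cg] by simp
qed (rule ip_nonneg[OF g])

end

context rkhs
begin

lemma kernel_combination:
  assumes \<alpha>: "\<alpha> \<in> fsupp A"
  defines "k \<equiv> (\<lambda>x\<in>A. pairing \<alpha> (\<lambda>s. K (s, x)))"
  shows "k \<in> H" and "f \<in> H \<Longrightarrow> ip f k = pairing \<alpha> f"
proof -
  have "(\<lambda>x\<in>A. \<Sum>s\<in>F. \<alpha> s * K (s, x)) \<in> H \<and>
      (\<forall>f\<in>H. ip (\<lambda>x\<in>A. \<Sum>s\<in>F. \<alpha> s * K (s, x)) f = (\<Sum>s\<in>F. \<alpha> s * f s))"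
    if "finite F" "F \<subseteq> A" for F
    using that
  proof (induction F rule: finite_induct)
    case empty
    have "ip (\<lambda>x\<in>A. 0) f = 0" if "f \<in> H" for f
      using ip_scale[OF that that, of 0] by simp
    then show ?case using zero unfolding sum.empty by blast
  next
    case (insert s F)
    let ?g = "\<lambda>x\<in>A. \<alpha> s * (\<lambda>x\<in>A. K (s, x)) x" and ?h = "\<lambda>x\<in>A. \<Sum>s\<in>F. \<alpha> s * K (s, x)"
    have s: "s \<in> A" using insert by simp
    have g: "?g \<in> H" by (intro scale kernel s)
    have IH: "?h \<in> H" "\<And>f. f \<in> H \<Longrightarrow> ip ?h f = (\<Sum>s\<in>F. \<alpha> s * f s)"
      using insert.IH insert.prems by blast+
    note h = IH(1)
    have eq: "(\<lambda>x\<in>A. \<Sum>s\<in>insert s F. \<alpha> s * K (s, x)) = (\<lambda>x\<in>A. ?g x + ?h x)"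
      using insert.hyps by (intro restrict_ext) simp
    have "ip (\<lambda>x\<in>A. ?g x + ?h x) f = (\<Sum>s\<in>insert s F. \<alpha> s * f s)" if f: "f \<in> H" for f
    proof -
      have "ip (\<lambda>x\<in>A. ?g x + ?h x) f = ip ?g f + ip ?h f" by (rule ip_add[OF g h f])
      also have "ip ?g f = \<alpha> s * f s"
        using ip_scale[OF kernel[OF s] f, of "\<alpha> s"] reproducing[OF f s] ip_commute[OF kernel[OF s] f]
        by simp
      also have "ip ?h f = (\<Sum>s\<in>F. \<alpha> s * f s)" by (rule IH(2)[OF f])
      also have "\<alpha> s * f s + (\<Sum>s\<in>F. \<alpha> s * f s) = (\<Sum>s\<in>insert s F. \<alpha> s * f s)"
        using insert.hyps by simp
      finally show ?thesis .
    qed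
    then show ?case unfolding eq using add[OF g h] by blast
  qed
  from this[of "{x. \<alpha> x \<noteq> 0}"] \<alpha>
  have *: "k \<in> H" "\<And>f. f \<in> H \<Longrightarrow> ip k f = pairing \<alpha> f"
    unfolding k_def pairing_def fsupp_def by auto
  show "k \<in> H" by fact
  show "ip f k = pairing \<alpha> f" if "f \<in> H" using *(2)[OF that] ip_commute[OF that *(1)] by simp
qed

lemma ip_diff_kernel_combination:
  assumes f: "f \<in> H" and \<alpha>: "\<alpha> \<in> fsupp A"
  defines "k \<equiv> (\<lambda>x\<in>A. pairing \<alpha> (\<lambda>s. K (s, x)))"
  shows "ip (\<lambda>x\<in>A. f x - k x) (\<lambda>x\<in>A. f x - k x) = ip f f - gain K f \<alpha>"
    and "ip k k = form K \<alpha> \<alpha>"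
proof -
  note k = kernel_combination[OF \<alpha>, folded k_def]
  have "pairing \<alpha> k = pairing \<alpha> (\<lambda>x. pairing \<alpha> (\<lambda>s. K (s, x)))"
    by (rule pairing_cong[OF \<alpha>]) (simp add: k_def)
  also have "\<dots> = form K \<alpha> \<alpha>" unfolding form_def by (rule pairing_swap)
  finally show kk: "ip k k = form K \<alpha> \<alpha>" using k by simp
  show "ip (\<lambda>x\<in>A. f x - k x) (\<lambda>x\<in>A. f x - k x) = ip f f - gain K f \<alpha>"
    using ip_diff_self[OF f k(1)] k(2)[OF f] kk by (simp add: gain_def)
qed

lemma gain_le_ip: "f \<in> H \<Longrightarrow> \<alpha> \<in> fsupp A \<Longrightarrow> gain K f \<alpha> \<le> ip f f"
  using ip_diff_kernel_combination(1)[of f \<alpha>] ip_nonneg[OF diff[OF _ kernel_combination(1)], of f \<alpha>]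
  by simp

text \<open>
  Coefficients whose gains approach the supremum give a Cauchy sequence of combinations, by the
  parallelogram law for gains. Since no direction \<open>K(s,\<cdot>)\<close> improves the gain in the limit, the limit
  of these combinations has the same values as \<open>f\<close>. So the norm is determined by the kernel alone,
  in every reproducing kernel Hilbert space.
\<close>

lemma ip_eq_energy:
  assumes cov: "covariance_on A K" and f: "f \<in> H"
  shows "finite_energy A K f" and "ip f f = energy A K f"
proof -
  show fin: "finite_energy A K f" by (rule finite_energyI, rule gain_le_ip[OF f])
  have le: "energy A K f \<le> ip f f" by (rule energy_le, rule gain_le_ip[OF f])
  let ?N = "energy A K f"
  have "\<exists>\<alpha>. \<alpha> \<in> fsupp A \<and> gain K f \<alpha> > ?N - inverse (real (Suc n))" for n
    using gain_near_energy[of "inverse (real (Suc n))" A K f] by auto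
  then obtain \<alpha> where \<alpha>: "\<And>n. \<alpha> n \<in> fsupp A"
      and near: "\<And>n. gain K f (\<alpha> n) > ?N - inverse (real (Suc n))" by metis
  define k where "k n = (\<lambda>x\<in>A. pairing (\<alpha> n) (\<lambda>s. K (s, x)))" for n
  have kH: "k n \<in> H" for n unfolding k_def by (rule kernel_combination(1)[OF \<alpha>])
  have dist: "ip (\<lambda>x\<in>A. k i x - k j x) (\<lambda>x\<in>A. k i x - k j x)
      \<le> 2 * inverse (real (Suc i)) + 2 * inverse (real (Suc j))" for i j
  proof -
    let ?d = "\<lambda>x. 1 * \<alpha> i x + (-1) * \<alpha> j x" and ?m = "\<lambda>x. 1/2 * \<alpha> i x + 1/2 * \<alpha> j x"
    have d: "?d \<in> fsupp A" and m: "?m \<in> fsupp A" by (intro fsupp_lincomb \<alpha>)+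
    have "(\<lambda>x\<in>A. k i x - k j x) = (\<lambda>x\<in>A. pairing ?d (\<lambda>s. K (s, x)))"
      unfolding pairing_lincomb_left[OF \<alpha> \<alpha>] by (auto simp: k_def)
    then have "ip (\<lambda>x\<in>A. k i x - k j x) (\<lambda>x\<in>A. k i x - k j x) = form K ?d ?d"
      using ip_diff_kernel_combination(2)[OF f d] by simp
    also have "\<dots> = 4 * gain K f ?m - 2 * gain K f (\<alpha> i) - 2 * gain K f (\<alpha> j)"
      unfolding gain_def form_square[OF cov \<alpha> \<alpha>] pairing_lincomb_left[OF \<alpha> \<alpha>]
      by (simp add: field_simps power2_eq_square)
    also have "\<dots> \<le> 2 * inverse (real (Suc i)) + 2 * inverse (real (Suc j))"
      using gain_le_energy[OF fin m] near[of i] near[of j] by linarith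
    finally show ?thesis .
  qed
  have "\<exists>h\<in>H. (\<lambda>n. sqrt (ip (\<lambda>x\<in>A. k n x - h x) (\<lambda>x\<in>A. k n x - h x))) \<longlonglongrightarrow> 0"
  proof (rule complete)
    show "range k \<subseteq> H" using kH by blast
    fix e :: real assume "e > 0"
    then have "e\<^sup>2 / 4 > 0" by simp
    then obtain N where N: "inverse (real (Suc N)) < e\<^sup>2 / 4" using reals_Archimedean by blast
    have "sqrt (ip (\<lambda>x\<in>A. k i x - k j x) (\<lambda>x\<in>A. k i x - k j x)) < e" if "i \<ge> N" "j \<ge> N" for i j
    proof -
      have "inverse (real (Suc i)) \<le> inverse (real (Suc N))" "inverse (real (Suc j)) \<le> inverse (real (Suc N))"
        using that by (auto intro!: le_imp_inverse_le)
      then have "ip (\<lambda>x\<in>A. k i x - k j x) (\<lambda>x\<in>A. k i x - k j x) < e\<^sup>2"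
        using dist[of i j] N by linarith
      then show ?thesis using \<open>e > 0\<close> by (simp add: real_less_lsqrt)
    qed
    then show "\<exists>N. \<forall>i\<ge>N. \<forall>j\<ge>N. sqrt (ip (\<lambda>x\<in>A. k i x - k j x) (\<lambda>x\<in>A. k i x - k j x)) < e" by blast
  qed
  then obtain h where h: "h \<in> H"
    and lim: "(\<lambda>n. sqrt (ip (\<lambda>x\<in>A. k n x - h x) (\<lambda>x\<in>A. k n x - h x))) \<longlonglongrightarrow> 0" by blast
  have pointwise: "(\<lambda>n. k n s) \<longlonglongrightarrow> h s" if s: "s \<in> A" for s
  proof -
    have bound: "norm (k n s - h s) \<le> sqrt (ip (\<lambda>x\<in>A. k n x - h x) (\<lambda>x\<in>A. k n x - h x)) * sqrt (K (s, s))" for n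
    proof -
      let ?g = "\<lambda>x\<in>A. k n x - h x"
      have g: "?g \<in> H" by (rule diff[OF kH h])
      have "(?g s)\<^sup>2 \<le> ip ?g ?g * K (s, s)"
        using ip_Cauchy_Schwarz[OF g kernel[OF s]] reproducing[OF g s] reproducing[OF kernel[OF s] s] s
        by simp
      then have "sqrt ((?g s)\<^sup>2) \<le> sqrt (ip ?g ?g * K (s, s))" by (rule real_sqrt_le_mono)
      then show ?thesis using s by (simp add: real_sqrt_mult)
    qed
    have "(\<lambda>n. sqrt (ip (\<lambda>x\<in>A. k n x - h x) (\<lambda>x\<in>A. k n x - h x)) * sqrt (K (s, s))) \<longlonglongrightarrow> 0"
      using tendsto_mult_right[OF lim, of "sqrt (K (s, s))"] by simp
    then have "(\<lambda>n. k n s - h s) \<longlonglongrightarrow> 0"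
      by (rule Lim_null_comparison[OF always_eventually[OF allI[OF bound]]])
    then show ?thesis by (rule LIM_zero_cancel)
  qed
  \<comment> \<open>First-order optimality of a maximizing sequence identifies its limit with \<open>f\<close>.\<close>
  have "f s = h s" if s: "s \<in> A" for s
  proof -
    have opt: "0 \<le> 0 + 2 * c * (h s - f s) + c\<^sup>2 * K (s, s)" for c
    proof (rule LIMSEQ_le_const)
      show "(\<lambda>n. inverse (real (Suc n)) + 2 * c * (k n s - f s) + c\<^sup>2 * K (s, s))
          \<longlonglongrightarrow> 0 + 2 * c * (h s - f s) + c\<^sup>2 * K (s, s)"
        by (intro tendsto_intros LIMSEQ_inverse_real_of_nat pointwise s)
      have "0 \<le> inverse (real (Suc n)) + 2 * c * (k n s - f s) + c\<^sup>2 * K (s, s)" for n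
      proof -
        let ?a = "\<lambda>x. 1 * \<alpha> n x + c * delta s x"
        have "form K (\<alpha> n) (delta s) = k n s" using s by (simp add: form_def k_def)
        then have "gain K f ?a = gain K f (\<alpha> n) + 2 * c * (f s - k n s) - c\<^sup>2 * K (s, s)"
          unfolding gain_def form_square[OF cov \<alpha> delta_in_fsupp[OF s]]
            pairing_lincomb_left[OF \<alpha> delta_in_fsupp[OF s]] by (simp add: algebra_simps)
        then have "gain K f (\<alpha> n) + 2 * c * (f s - k n s) - c\<^sup>2 * K (s, s) \<le> ?N"
          using gain_le_energy[OF fin fsupp_lincomb[OF \<alpha> delta_in_fsupp[OF s]], of 1 n c] by simp
        moreover have "2 * c * (f s - k n s) = - (2 * c * (k n s - f s))" by (simp add: algebra_simps)
        ultimately show ?thesis using near[of n] by linarith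
      qed
      then show "\<exists>N. \<forall>n\<ge>N. 0 \<le> inverse (real (Suc n)) + 2 * c * (k n s - f s) + c\<^sup>2 * K (s, s)" by blast
    qed
    have "(h s - f s)\<^sup>2 \<le> 0 * K (s, s)"
      by (rule quadratic_nonneg_discriminant[OF opt covariance_diag_nonneg[OF cov s]])
    then show ?thesis by simp
  qed
  then have fh: "f = h" using f h carrier by (intro extensionalityI[of f A h]) auto
  have "ip f f - gain K f (\<alpha> n) = (sqrt (ip (\<lambda>x\<in>A. k n x - f x) (\<lambda>x\<in>A. k n x - f x)))\<^sup>2" for n
  proof -
    have "ip (\<lambda>x\<in>A. k n x - f x) (\<lambda>x\<in>A. k n x - f x) = ip (\<lambda>x\<in>A. f x - k n x) (\<lambda>x\<in>A. f x - k n x)"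
      using ip_diff_self[OF f kH] ip_diff_self[OF kH f] ip_commute[OF f kH] by simp
    also have "\<dots> = ip f f - gain K f (\<alpha> n)"
      unfolding k_def by (rule ip_diff_kernel_combination(1)[OF f \<alpha>])
    finally show ?thesis using real_sqrt_pow2[OF ip_nonneg[OF diff[OF kH[of n] f]]] by (simp only:)
  qed
  then have "(\<lambda>n. ip f f - gain K f (\<alpha> n)) \<longlonglongrightarrow> 0"
    using tendsto_power[OF lim, of 2] unfolding fh by simp
  moreover have "ip f f - ?N \<le> ip f f - gain K f (\<alpha> n)" for n
    using gain_le_energy[OF fin \<alpha>] by simp
  ultimately have "ip f f - ?N \<le> 0" by (intro LIMSEQ_le_const) auto
  with le show "ip f f = ?N" by simp
qed

lemma ip_eq_energy_inner:
  assumes cov: "covariance_on A K" and f: "f \<in> H" and g: "g \<in> H"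
  shows "ip f g = energy_inner A K f g"
proof -
  have "energy A K (\<lambda>x\<in>A. f x + g x) = energy A K (\<lambda>x. f x + g x)"
    "energy A K (\<lambda>x\<in>A. f x - g x) = energy A K (\<lambda>x. f x - g x)"
    by (intro energy_cong; simp)+
  then show ?thesis
    using ip_eq_energy(2)[OF cov add[OF f g]] ip_eq_energy(2)[OF cov diff[OF f g]]
      ip_add_self[OF f g] ip_diff_self[OF f g] by (simp add: energy_inner_def)
qed

end

theorem rkhs_inner_eq_energy_inner:
  assumes cov: "covariance_on A K" and f: "f \<in> kernel_space A K" and g: "g \<in> kernel_space A K"
  shows "rkhs_inner A K f g = energy_inner A K f g"
  unfolding rkhs_inner_def
proof (rule the_equality)
  show "\<exists>H ip. rkhs A K H ip \<and> f \<in> H \<and> g \<in> H \<and> ip f g = energy_inner A K f g"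
    using rkhs_kernel_space[OF cov] f g by blast
  show "v = energy_inner A K f g" if "\<exists>H ip. rkhs A K H ip \<and> f \<in> H \<and> g \<in> H \<and> ip f g = v" for v
    using that rkhs.ip_eq_energy_inner[OF _ cov] by metis
qed

section \<open>Schur complements and closed spans\<close>

text \<open>
  The Schur complement as a kernel on the whole larger set. It vanishes as soon as one argument
  lies in \<open>A\<close>, so no information is added, but it can be summed with other kernels.
\<close>

definition residual :: "('a \<times> 'a \<Rightarrow> real) \<Rightarrow> 'a set \<Rightarrow> 'a \<times> 'a \<Rightarrow> real" where
  "residual K A = (\<lambda>(s, t). K (s, t) - energy_inner A K (\<lambda>x. K (s, x)) (\<lambda>x. K (t, x)))"

definition closed_span :: "('a \<times> 'a \<Rightarrow> real) \<Rightarrow> 'a set \<Rightarrow> ('a \<Rightarrow> real) set" where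
  "closed_span K A =
     {\<beta>. \<forall>e>0. \<exists>\<alpha>\<in>fsupp A. form K (\<lambda>x. \<beta> x - \<alpha> x) (\<lambda>x. \<beta> x - \<alpha> x) < e}"

lemma finite_energy_pairing:
  assumes cov: "covariance_on A K" and h: "\<And>s. s \<in> X \<Longrightarrow> finite_energy A K (h s)" and \<alpha>: "\<alpha> \<in> fsupp X"
  shows "finite_energy A K (\<lambda>x. pairing \<alpha> (\<lambda>s. h s x))"
    and "finite_energy A K g \<Longrightarrow>
      energy_inner A K (\<lambda>x. pairing \<alpha> (\<lambda>s. h s x)) g = pairing \<alpha> (\<lambda>s. energy_inner A K (h s) g)"
proof -
  have sums: "finite_energy A K (\<lambda>x. \<Sum>s\<in>F. \<alpha> s * h s x) \<and>
      (\<forall>g. finite_energy A K g \<longrightarrow> energy_inner A K (\<lambda>x. \<Sum>s\<in>F. \<alpha> s * h s x) g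
        = (\<Sum>s\<in>F. \<alpha> s * energy_inner A K (h s) g))" if "finite F" "F \<subseteq> X" for F
    using that
  proof (induction F rule: finite_induct)
    case empty
    have "energy_inner A K (\<lambda>x. 0) g = 0" if "finite_energy A K g" for g
      using energy_inner_scale[OF cov that that, of 0]
        energy_inner_scale[OF cov finite_energy_zero[OF cov] that, of 0] by simp
    then show ?case using finite_energy_zero[OF cov] by simp
  next
    case (insert s F)
    have s: "finite_energy A K (\<lambda>x. \<alpha> s * h s x)"
      using insert.prems by (intro finite_energy_scale[OF cov] h) simp
    have F: "finite_energy A K (\<lambda>x. \<Sum>s\<in>F. \<alpha> s * h s x)"
      "\<And>g. finite_energy A K g \<Longrightarrow> energy_inner A K (\<lambda>x. \<Sum>s\<in>F. \<alpha> s * h s x) g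
        = (\<Sum>s\<in>F. \<alpha> s * energy_inner A K (h s) g)"
      using insert.IH insert.prems by blast+
    have eq: "(\<lambda>x. \<Sum>s\<in>insert s F. \<alpha> s * h s x) = (\<lambda>x. \<alpha> s * h s x + (\<Sum>s\<in>F. \<alpha> s * h s x))"
      using insert.hyps by auto
    show ?case
      unfolding eq using finite_energy_add[OF cov s F(1)] energy_inner_add[OF cov s F(1)] F(2)
        energy_inner_scale[OF cov h, of s] insert.hyps insert.prems by simp
  qed
  have supp: "finite {s. \<alpha> s \<noteq> 0}" "{s. \<alpha> s \<noteq> 0} \<subseteq> X" using \<alpha> by (auto simp: fsupp_def)
  show "finite_energy A K (\<lambda>x. pairing \<alpha> (\<lambda>s. h s x))"
    using sums[OF supp] unfolding pairing_def by blast
  show "energy_inner A K (\<lambda>x. pairing \<alpha> (\<lambda>s. h s x)) g = pairing \<alpha> (\<lambda>s. energy_inner A K (h s) g)"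
    if "finite_energy A K g" using sums[OF supp] that unfolding pairing_def by blast
qed

text \<open>
  Bilinearity reduces the form of a Gram kernel to one energy, which shows that Gram kernels are
  covariances.
\<close>

lemma form_Gram:
  assumes cov: "covariance_on A K" and h: "\<And>s. s \<in> X \<Longrightarrow> finite_energy A K (h s)" and \<alpha>: "\<alpha> \<in> fsupp X"
  shows "form (\<lambda>(s, t). energy_inner A K (h s) (h t)) \<alpha> \<alpha> = energy A K (\<lambda>x. pairing \<alpha> (\<lambda>s. h s x))"
proof -
  define g where "g x = pairing \<alpha> (\<lambda>s. h s x)" for x
  have fin: "finite_energy A K g"
    using finite_energy_pairing(1)[OF cov h \<alpha>] by (simp add: g_def[abs_def])
  have left: "energy_inner A K g f = pairing \<alpha> (\<lambda>s. energy_inner A K (h s) f)"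
    if "finite_energy A K f" for f
    using finite_energy_pairing(2)[OF cov h \<alpha> that] by (simp add: g_def[abs_def])
  have "form (\<lambda>(s, t). energy_inner A K (h s) (h t)) \<alpha> \<alpha>
      = pairing \<alpha> (\<lambda>s. pairing \<alpha> (\<lambda>t. energy_inner A K (h t) (h s)))"
    unfolding form_def
    by (intro pairing_cong[OF \<alpha>]) (simp add: energy_inner_commute[OF cov h h])
  also have "\<dots> = pairing \<alpha> (\<lambda>s. energy_inner A K (h s) g)"
    by (intro pairing_cong[OF \<alpha>])
      (simp add: left[OF h, symmetric] energy_inner_commute[OF cov fin h])
  also have "\<dots> = energy_inner A K g g" by (rule left[OF fin, symmetric])
  also have "\<dots> = energy A K g" by (rule energy_inner_self[OF cov fin])
  finally show ?thesis by (simp add: g_def[abs_def])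
qed

lemma covariance_Gram:
  assumes cov: "covariance_on A K" and h: "\<And>s. s \<in> X \<Longrightarrow> finite_energy A K (h s)"
  shows "covariance_on X (\<lambda>(s, t). energy_inner A K (h s) (h t))"
  unfolding covariance_on_iff_form
proof (intro conjI ballI)
  show "form (\<lambda>(s, t). energy_inner A K (h s) (h t)) \<alpha> \<alpha> \<ge> 0" if "\<alpha> \<in> fsupp X" for \<alpha>
    using form_Gram[where h = h, OF cov _ that] finite_energy_pairing(1)[where h = h, OF cov _ that]
      energy_nonneg h by simp
qed (simp add: energy_inner_commute[OF cov h h])

lemma covariance_rank_one: "covariance_on X (\<lambda>(s, t). u s * u t)"
  unfolding covariance_on_iff_form by (simp add: form_rank_one)

text \<open>
  The squared distance between two combinations, read as a gain: this is why suprema of gains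
  measure distances from spans.
\<close>

lemma form_diff_square:
  assumes cov: "covariance_on B K" and \<alpha>: "\<alpha> \<in> fsupp B" and \<beta>: "\<beta> \<in> fsupp B"
  shows "form K (\<lambda>x. \<beta> x - \<alpha> x) (\<lambda>x. \<beta> x - \<alpha> x)
    = form K \<beta> \<beta> - gain K (\<lambda>x. pairing \<beta> (\<lambda>s. K (s, x))) \<alpha>"
proof -
  have "pairing \<alpha> (\<lambda>x. pairing \<beta> (\<lambda>s. K (s, x))) = form K \<beta> \<alpha>"
    unfolding form_def by (rule pairing_swap)
  then show ?thesis
    using form_square[OF cov \<beta> \<alpha>, of 1 "-1"] by (simp add: gain_def)
qed

context
  fixes A B :: "'a set" and K :: "'a \<times> 'a \<Rightarrow> real"
  assumes covB: "covariance_on B K" and AB: "A \<subseteq> B"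
begin

lemma gain_pairing_kernel_le:
  assumes "\<alpha> \<in> fsupp A" "\<beta> \<in> fsupp B"
  shows "gain K (\<lambda>x. pairing \<beta> (\<lambda>s. K (s, x))) \<alpha> \<le> form K \<beta> \<beta>"
  using form_diff_square[OF covB fsupp_mono[OF assms(1) AB] assms(2)]
    covariance_form_nonneg[OF covB fsupp_diff[OF assms(2) fsupp_mono[OF assms(1) AB]]] by simp

text \<open>
  For \<open>s\<close> outside \<open>A\<close> too, the section restricted to \<open>A\<close> belongs to the space of \<open>A\<close>: it is
  the projection of \<open>k\<^sub>s\<close>. Without this the inner product in the Schur complement would be
  meaningless.
\<close>

lemma finite_energy_kernel_section: "s \<in> B \<Longrightarrow> finite_energy A K (\<lambda>x. K (s, x))"
  using gain_pairing_kernel_le[OF _ delta_in_fsupp, of _ s] by (intro finite_energyI[where c = "K (s, s)"]) simp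

lemma covariance_residual: "covariance_on B (residual K A)"
  unfolding covariance_on_iff_form
proof (intro conjI ballI)
  show "residual K A (s, t) = residual K A (t, s)" if "s \<in> B" "t \<in> B" for s t
    using covariance_commute[OF covB that]
      energy_inner_commute[OF covariance_subset[OF covB AB] finite_energy_kernel_section finite_energy_kernel_section] that
    by (simp add: residual_def)
  show "form (residual K A) \<beta> \<beta> \<ge> 0" if \<beta>: "\<beta> \<in> fsupp B" for \<beta>
  proof -
    have "form (residual K A) \<beta> \<beta> = form K \<beta> \<beta> - energy A K (\<lambda>x. pairing \<beta> (\<lambda>s. K (s, x)))"
      using form_diff[of K "\<lambda>(s, t). energy_inner A K (\<lambda>x. K (s, x)) (\<lambda>x. K (t, x))" \<beta> \<beta>]
        form_Gram[OF covariance_subset[OF covB AB] finite_energy_kernel_section \<beta>]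
      by (simp add: residual_def)
    moreover have "energy A K (\<lambda>x. pairing \<beta> (\<lambda>s. K (s, x))) \<le> form K \<beta> \<beta>"
      by (rule energy_le, rule gain_pairing_kernel_le[OF _ \<beta>])
    ultimately show ?thesis by simp
  qed
qed

lemma residual_zero_right: "s \<in> B \<Longrightarrow> t \<in> A \<Longrightarrow> residual K A (s, t) = 0"
  by (simp add: residual_def energy_inner_reproducing[OF covariance_subset[OF covB AB] finite_energy_kernel_section])

lemma residual_zero_left: "s \<in> A \<Longrightarrow> t \<in> B \<Longrightarrow> residual K A (s, t) = 0"
  using residual_zero_right[of t s] covariance_commute[OF covariance_residual, of s t] AB by auto

text \<open>
  The residual variance at \<open>s\<close> is \<open>K (s, s)\<close> minus a supremum of gains, that is the infimum of the
  squared distances from \<open>k\<^sub>s\<close> to combinations supported in \<open>A\<close>.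
\<close>

lemma residual_diag_zero_iff:
  assumes s: "s \<in> B"
  shows "residual K A (s, s) = 0 \<longleftrightarrow> delta s \<in> closed_span K A"
proof -
  let ?E = "energy A K (\<lambda>x. K (s, x))"
  note fin = finite_energy_kernel_section[OF s]
  have res: "residual K A (s, s) = K (s, s) - ?E"
    by (simp add: residual_def energy_inner_self[OF covariance_subset[OF covB AB] fin])
  have le: "?E \<le> K (s, s)"
    using covariance_diag_nonneg[OF covariance_residual s] res by simp
  have dist: "form K (\<lambda>x. delta s x - \<alpha> x) (\<lambda>x. delta s x - \<alpha> x) = K (s, s) - gain K (\<lambda>x. K (s, x)) \<alpha>"
    if "\<alpha> \<in> fsupp A" for \<alpha>
    using form_diff_square[OF covB fsupp_mono[OF that AB] delta_in_fsupp[OF s]] by simp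
  show ?thesis
  proof
    assume "residual K A (s, s) = 0"
    then have E: "?E = K (s, s)" using res by simp
    show "delta s \<in> closed_span K A"
      unfolding closed_span_def
    proof (intro CollectI allI impI)
      fix e :: real assume "e > 0"
      then obtain \<alpha> where \<alpha>: "\<alpha> \<in> fsupp A" "gain K (\<lambda>x. K (s, x)) \<alpha> > ?E - e"
        by (rule gain_near_energy)
      then show "\<exists>\<alpha>\<in>fsupp A. form K (\<lambda>x. delta s x - \<alpha> x) (\<lambda>x. delta s x - \<alpha> x) < e"
        using dist[OF \<alpha>(1)] E by (intro bexI[OF _ \<alpha>(1)]) simp
    qed
  next
    assume span: "delta s \<in> closed_span K A"
    have "K (s, s) \<le> ?E"
    proof (rule field_le_epsilon)
      fix e :: real assume "e > 0"
      with span obtain \<alpha> where \<alpha>: "\<alpha> \<in> fsupp A"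
        "form K (\<lambda>x. delta s x - \<alpha> x) (\<lambda>x. delta s x - \<alpha> x) < e"
        unfolding closed_span_def by blast
      show "K (s, s) \<le> ?E + e"
        using dist[OF \<alpha>(1)] \<alpha>(2) gain_le_energy[OF fin \<alpha>(1)] by simp
    qed
    then show "residual K A (s, s) = 0" using le res by simp
  qed
qed

lemma schur_complement_eq_residual:
  assumes s: "s \<in> B - A" and t: "t \<in> B - A"
  shows "schur_complement K B A (s, t) = residual K A (s, t)"
proof -
  have "(\<lambda>x\<in>A. K (x, t)) = (\<lambda>x\<in>A. K (t, x))"
    using covariance_commute[OF covB] t AB by (intro restrict_ext) auto
  moreover have "(\<lambda>x\<in>A. K (r, x)) \<in> kernel_space A K" if "r \<in> B" for r
    using finite_energy_kernel_section[OF that] by (simp add: kernel_space_def)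
  ultimately have "rkhs_inner A K (\<lambda>x\<in>A. K (s, x)) (\<lambda>x\<in>A. K (x, t))
      = energy_inner A K (\<lambda>x\<in>A. K (s, x)) (\<lambda>x\<in>A. K (t, x))"
    using rkhs_inner_eq_energy_inner[OF covariance_subset[OF covB AB]] s t by simp
  then show ?thesis using s t by (simp add: schur_complement_def residual_def)
qed

text \<open>
  By Cauchy--Schwarz the Schur complement vanishes iff its diagonal does. Points of \<open>A\<close> may be
  included on the right because they span themselves.
\<close>

lemma schur_complement_zero_iff:
  "(\<forall>s\<in>B - A. \<forall>t\<in>B - A. schur_complement K B A (s, t) = 0) \<longleftrightarrow> (\<forall>s\<in>B. delta s \<in> closed_span K A)"
proof (intro iffI ballI)
  fix s assume "\<forall>s\<in>B - A. \<forall>t\<in>B - A. schur_complement K B A (s, t) = 0" and s: "s \<in> B"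
  then have "residual K A (s, s) = 0"
    using schur_complement_eq_residual[of s s] residual_zero_right[of s s] by (cases "s \<in> A") auto
  then show "delta s \<in> closed_span K A" using residual_diag_zero_iff[OF s] by simp
next
  fix s t assume span: "\<forall>s\<in>B. delta s \<in> closed_span K A" and s: "s \<in> B - A" and t: "t \<in> B - A"
  have "(residual K A (s, t))\<^sup>2 \<le> residual K A (s, s) * residual K A (t, t)"
    using s t by (intro covariance_Cauchy_Schwarz[OF covariance_residual]) auto
  then have "residual K A (s, t) = 0" using residual_diag_zero_iff[of s] span s by simp
  then show "schur_complement K B A (s, t) = 0" by (simp add: schur_complement_eq_residual[OF s t])
qed

end

lemma closed_span_cong:
  assumes "\<And>s t. s \<in> B \<Longrightarrow> t \<in> B \<Longrightarrow> K (s, t) = L (s, t)" "A \<subseteq> B" "\<beta> \<in> fsupp B"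
  shows "\<beta> \<in> closed_span K A \<longleftrightarrow> \<beta> \<in> closed_span L A"
proof -
  have "form K (\<lambda>x. \<beta> x - \<alpha> x) (\<lambda>x. \<beta> x - \<alpha> x) = form L (\<lambda>x. \<beta> x - \<alpha> x) (\<lambda>x. \<beta> x - \<alpha> x)"
    if "\<alpha> \<in> fsupp A" for \<alpha>
    using fsupp_diff[OF assms(3) fsupp_mono[OF that assms(2)]] assms(1)
    by (intro form_cong[where A = B and B = B]) auto
  then show ?thesis unfolding closed_span_def by simp
qed

lemma closed_span_mono: "\<beta> \<in> closed_span K A \<Longrightarrow> A \<subseteq> A' \<Longrightarrow> \<beta> \<in> closed_span K A'"
  unfolding closed_span_def using fsupp_mono by blast

lemma fsupp_in_closed_span:
  assumes "\<beta> \<in> fsupp A"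
  shows "\<beta> \<in> closed_span K A"
proof -
  have "form K (\<lambda>x. \<beta> x - \<beta> x) (\<lambda>x. \<beta> x - \<beta> x) = 0" by simp
  then show ?thesis unfolding closed_span_def using assms by force
qed

context
  fixes B :: "'a set" and K :: "'a \<times> 'a \<Rightarrow> real"
  assumes cov: "covariance_on B K"
begin

text \<open>
  Plays the role of the triangle inequality, in terms of squared seminorms.
\<close>

lemma form_sum_le:
  assumes "\<alpha> \<in> fsupp B" "\<beta> \<in> fsupp B"
  shows "form K (\<lambda>x. \<alpha> x + \<beta> x) (\<lambda>x. \<alpha> x + \<beta> x) \<le> 2 * form K \<alpha> \<alpha> + 2 * form K \<beta> \<beta>"
  using form_square[OF cov assms, of 1 1] form_square[OF cov assms, of 1 "-1"]
    covariance_form_nonneg[OF cov fsupp_lincomb[OF assms, of 1 "-1"]] by simp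

lemma closed_span_add_scaled:
  assumes "A \<subseteq> B" "\<beta> \<in> fsupp B" "\<gamma> \<in> fsupp B" "\<beta> \<in> closed_span K A" "\<gamma> \<in> closed_span K A"
  shows "(\<lambda>x. \<beta> x + c * \<gamma> x) \<in> closed_span K A"
  unfolding closed_span_def
proof (intro CollectI allI impI)
  fix e :: real assume e: "e > 0"
  have d: "e / (4 * (c\<^sup>2 + 1)) > 0" using e by (simp add: add_nonneg_pos)
  obtain \<alpha>1 where \<alpha>1: "\<alpha>1 \<in> fsupp A" "form K (\<lambda>x. \<beta> x - \<alpha>1 x) (\<lambda>x. \<beta> x - \<alpha>1 x) < e / 4"
    using assms(4) e unfolding closed_span_def by (auto dest: spec[of _ "e/4"])
  obtain \<alpha>2 where \<alpha>2: "\<alpha>2 \<in> fsupp A"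
      "form K (\<lambda>x. \<gamma> x - \<alpha>2 x) (\<lambda>x. \<gamma> x - \<alpha>2 x) < e / (4 * (c\<^sup>2 + 1))"
    using assms(5) d unfolding closed_span_def by blast
  have B: "\<alpha>1 \<in> fsupp B" "\<alpha>2 \<in> fsupp B" using \<alpha>1 \<alpha>2 assms(1) fsupp_mono by blast+
  let ?\<alpha> = "\<lambda>x. 1 * \<alpha>1 x + c * \<alpha>2 x"
  define b where "b x = \<beta> x - \<alpha>1 x" for x
  define g where "g x = \<gamma> x - \<alpha>2 x" for x
  have bg: "b \<in> fsupp B" "g \<in> fsupp B"
    using assms B by (auto simp: b_def[abs_def] g_def[abs_def] intro: fsupp_diff)
  have "form K (\<lambda>x. c * g x) (\<lambda>x. c * g x) = c\<^sup>2 * form K g g"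
    using form_square[OF cov bg(2) bg(2), of c 0] by simp
  also have "\<dots> \<le> c\<^sup>2 * (e / (4 * (c\<^sup>2 + 1)))"
    using \<alpha>2(2) unfolding g_def[abs_def] by (intro mult_left_mono) auto
  also have "\<dots> = e / 4 * (c\<^sup>2 / (c\<^sup>2 + 1))" by simp
  also have "\<dots> \<le> e / 4 * 1"
    using e by (intro mult_left_mono) (simp_all add: divide_le_eq_1 add_nonneg_pos)
  finally have "form K (\<lambda>x. c * g x) (\<lambda>x. c * g x) \<le> e / 4" by simp
  then have "form K (\<lambda>x. b x + c * g x) (\<lambda>x. b x + c * g x) < e"
    using form_sum_le[OF bg(1) fsupp_scale[OF bg(2), of c]] \<alpha>1(2) by (simp add: b_def[abs_def])
  moreover have "(\<lambda>x. b x + c * g x) = (\<lambda>x. \<beta> x + c * \<gamma> x - ?\<alpha> x)"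
    by (auto simp: b_def g_def algebra_simps)
  ultimately show "\<exists>\<alpha>\<in>fsupp A. form K (\<lambda>x. \<beta> x + c * \<gamma> x - \<alpha> x) (\<lambda>x. \<beta> x + c * \<gamma> x - \<alpha> x) < e"
    using fsupp_lincomb[OF \<alpha>1(1) \<alpha>2(1), of 1 c] by (intro bexI[of _ ?\<alpha>]) auto
qed

lemma fsupp_in_closed_span_if_points:
  assumes "A \<subseteq> B" "A' \<subseteq> B" "\<And>a. a \<in> A \<Longrightarrow> delta a \<in> closed_span K A'" "\<alpha> \<in> fsupp A"
  shows "\<alpha> \<in> closed_span K A'"
proof -
  have "(\<lambda>x. if x \<in> F then \<alpha> x else 0) \<in> closed_span K A'" if "finite F" "F \<subseteq> A" for F
    using that
  proof (induction F rule: finite_induct)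
    case empty
    then show ?case using fsupp_in_closed_span[OF zero_in_fsupp] by simp
  next
    case (insert s F)
    have fs: "(\<lambda>x. if x \<in> F then \<alpha> x else 0) \<in> fsupp B"
      using insert.hyps insert.prems assms(1) by (auto simp: fsupp_def)
    have "(\<lambda>x. (if x \<in> F then \<alpha> x else 0) + \<alpha> s * delta s x) \<in> closed_span K A'"
      using insert assms by (intro closed_span_add_scaled fs delta_in_fsupp) auto
    moreover have "(\<lambda>x. (if x \<in> F then \<alpha> x else 0) + \<alpha> s * delta s x)
        = (\<lambda>x. if x \<in> insert s F then \<alpha> x else 0)"
      using insert.hyps by (auto simp: delta_def)
    ultimately show ?case by simp
  qed
  from this[of "{x. \<alpha> x \<noteq> 0}"] have "(\<lambda>x. if \<alpha> x \<noteq> 0 then \<alpha> x else 0) \<in> closed_span K A'"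
    using assms(4) by (simp add: fsupp_def)
  moreover have "(\<lambda>x. if \<alpha> x \<noteq> 0 then \<alpha> x else 0) = \<alpha>" by auto
  ultimately show ?thesis by simp
qed

text \<open>
  This lets closed spans be passed on from one overlap of intervals to the next.
\<close>

lemma closed_span_trans:
  assumes "A \<subseteq> B" "A' \<subseteq> B" "\<beta> \<in> fsupp B"
    and \<beta>: "\<beta> \<in> closed_span K A" and points: "\<And>a. a \<in> A \<Longrightarrow> delta a \<in> closed_span K A'"
  shows "\<beta> \<in> closed_span K A'"
  unfolding closed_span_def
proof (intro CollectI allI impI)
  fix e :: real assume "e > 0"
  then have e: "e / 4 > 0" by simp
  obtain \<alpha> where \<alpha>: "\<alpha> \<in> fsupp A" "form K (\<lambda>x. \<beta> x - \<alpha> x) (\<lambda>x. \<beta> x - \<alpha> x) < e / 4"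
    using \<beta> e unfolding closed_span_def by blast
  have "\<alpha> \<in> closed_span K A'" using fsupp_in_closed_span_if_points[OF assms(1,2) points \<alpha>(1)] .
  then obtain \<gamma> where \<gamma>: "\<gamma> \<in> fsupp A'" "form K (\<lambda>x. \<alpha> x - \<gamma> x) (\<lambda>x. \<alpha> x - \<gamma> x) < e / 4"
    using e unfolding closed_span_def by blast
  have "form K (\<lambda>x. (\<beta> x - \<alpha> x) + (\<alpha> x - \<gamma> x)) (\<lambda>x. (\<beta> x - \<alpha> x) + (\<alpha> x - \<gamma> x)) < e"
    using form_sum_le[OF fsupp_diff fsupp_diff, of \<beta> \<alpha> \<alpha> \<gamma>] \<alpha> \<gamma> assms(1-3) fsupp_mono by force
  then show "\<exists>\<gamma>\<in>fsupp A'. form K (\<lambda>x. \<beta> x - \<gamma> x) (\<lambda>x. \<beta> x - \<gamma> x) < e"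
    using \<gamma>(1) by (intro bexI[of _ \<gamma>]) simp_all
qed

end

section \<open>Gluing two covariances along their intersection\<close>

text \<open>
  The glued covariance is a sum of four covariances: the Gram kernel of the projections onto the
  space of \<open>C\<close>, the residual of each side with a rank-one part \<open>u u\<^sup>T\<close> or \<open>v v\<^sup>T\<close> removed, and
  \<open>(u + c v) (u + c v)\<^sup>T\<close>. Since \<open>c\<^sup>2 = 1\<close>, the last one restores what was removed inside
  \<open>A \<times> A\<close> and \<open>B \<times> B\<close>; between the two sides it leaves the cross term \<open>c u v\<^sup>T\<close>, whose
  sign is free.
\<close>

lemma glue_covariances:
  fixes A B :: "'a set" and M :: "'a \<times> 'a \<Rightarrow> real" and u v :: "'a \<Rightarrow> real" and c :: real
  defines "C \<equiv> A \<inter> B"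
  assumes A: "covariance_on A M" and B: "covariance_on B M"
    and u: "covariance_on A (\<lambda>(s, t). residual M C (s, t) - u s * u t)"
    and v: "covariance_on B (\<lambda>(s, t). residual M C (s, t) - v s * v t)"
    and u0: "\<And>s. s \<in> B \<Longrightarrow> u s = 0" and v0: "\<And>s. s \<in> A \<Longrightarrow> v s = 0"
    and c: "c\<^sup>2 = 1"
  obtains L where "covariance_on (A \<union> B) L"
    "\<And>s t. s \<in> A \<Longrightarrow> t \<in> A \<Longrightarrow> L (s, t) = M (s, t)"
    "\<And>s t. s \<in> B \<Longrightarrow> t \<in> B \<Longrightarrow> L (s, t) = M (s, t)"
    "\<And>s t. s \<in> A - B \<Longrightarrow> t \<in> B - A \<Longrightarrow>
       L (s, t) = energy_inner C M (\<lambda>x. M (s, x)) (\<lambda>x. M (t, x)) + c * u s * v t"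
proof
  have CA: "C \<subseteq> A" and CB: "C \<subseteq> B" by (auto simp: C_def)
  define G where "G = (\<lambda>(s, t). energy_inner C M (\<lambda>x. M (s, x)) (\<lambda>x. M (t, x)))"
  define RA where "RA = (\<lambda>(s, t). if s \<in> A \<and> t \<in> A then residual M C (s, t) - u s * u t else 0)"
  define RB where "RB = (\<lambda>(s, t). if s \<in> B \<and> t \<in> B then residual M C (s, t) - v s * v t else 0)"
  define W where "W = (\<lambda>(s, t). (u s + c * v s) * (u t + c * v t))"
  define L where "L = (\<lambda>p. G p + (RA p + (RB p + W p)))"
  have "covariance_on (A \<union> B) G"
    unfolding G_def
    using finite_energy_kernel_section[OF A CA] finite_energy_kernel_section[OF B CB]
    by (intro covariance_Gram[OF covariance_subset[OF A CA]]) auto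
  moreover have "covariance_on (A \<union> B) RA"
    by (rule covariance_cong[OF covariance_extend_by_zero[OF u]]) (simp add: RA_def)
  moreover have "covariance_on (A \<union> B) RB"
    by (rule covariance_cong[OF covariance_extend_by_zero[OF v]]) (simp add: RB_def)
  moreover have "covariance_on (A \<union> B) W"
    unfolding W_def by (rule covariance_rank_one)
  ultimately show "covariance_on (A \<union> B) L"
    unfolding L_def by (intro covariance_add)
  have res: "residual M C (s, t) = M (s, t) - G (s, t)" for s t by (simp add: residual_def G_def)
  show "L (s, t) = M (s, t)" if s: "s \<in> A" and t: "t \<in> A" for s t
  proof -
    have "RB (s, t) = 0"
      using s t v0 residual_zero_left[OF A CA, of s t] by (auto simp: RB_def C_def)
    then show ?thesis using s t v0 by (simp add: L_def RA_def W_def res)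
  qed
  show "L (s, t) = M (s, t)" if s: "s \<in> B" and t: "t \<in> B" for s t
  proof -
    have "RA (s, t) = 0"
      using s t u0 residual_zero_left[OF A CA, of s t] by (auto simp: RA_def C_def)
    moreover have "W (s, t) = v s * v t"
      using s t u0 c by (simp add: W_def power2_eq_square algebra_simps)
    ultimately show ?thesis using s t by (simp add: L_def RB_def res)
  qed
  show "L (s, t) = energy_inner C M (\<lambda>x. M (s, x)) (\<lambda>x. M (t, x)) + c * u s * v t"
    if "s \<in> A - B" "t \<in> B - A" for s t
    using that u0 v0 by (simp add: L_def G_def RA_def RB_def W_def)
qed

text \<open>
  The orthogonal gluing, with \<open>u = v = 0\<close>.
\<close>

lemma amalgamate_covariances:
  assumes A: "covariance_on A LA" and B: "covariance_on B LB"
    and agree: "\<And>s t. s \<in> A \<inter> B \<Longrightarrow> t \<in> A \<inter> B \<Longrightarrow> LA (s, t) = LB (s, t)"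
  obtains L where "covariance_on (A \<union> B) L"
    "\<And>s t. s \<in> A \<Longrightarrow> t \<in> A \<Longrightarrow> L (s, t) = LA (s, t)"
    "\<And>s t. s \<in> B \<Longrightarrow> t \<in> B \<Longrightarrow> L (s, t) = LB (s, t)"
proof -
  define M where "M = (\<lambda>(s, t). if s \<in> A \<and> t \<in> A then LA (s, t) else LB (s, t))"
  have MA: "M (s, t) = LA (s, t)" if "s \<in> A" "t \<in> A" for s t using that by (simp add: M_def)
  have MB: "M (s, t) = LB (s, t)" if "s \<in> B" "t \<in> B" for s t using that agree by (simp add: M_def)
  have A': "covariance_on A M" using covariance_cong[OF A] MA by blast
  have B': "covariance_on B M" using covariance_cong[OF B] MB by blast
  have CA: "A \<inter> B \<subseteq> A" and CB: "A \<inter> B \<subseteq> B" by auto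
  have "covariance_on A (\<lambda>(s, t). residual M (A \<inter> B) (s, t) - 0 * 0)"
    "covariance_on B (\<lambda>(s, t). residual M (A \<inter> B) (s, t) - 0 * 0)"
    using covariance_residual[OF A' CA] covariance_residual[OF B' CB] by simp_all
  then obtain L where "covariance_on (A \<union> B) L"
    "\<And>s t. s \<in> A \<Longrightarrow> t \<in> A \<Longrightarrow> L (s, t) = M (s, t)"
    "\<And>s t. s \<in> B \<Longrightarrow> t \<in> B \<Longrightarrow> L (s, t) = M (s, t)"
    by (rule glue_covariances[where u = "\<lambda>_. 0" and v = "\<lambda>_. 0" and c = 1, OF A' B']) auto
  then show ?thesis using MA MB that by metis
qed

text \<open>
  Here \<open>u\<close> and \<open>v\<close> are the normalized residuals of \<open>s0\<close> and \<open>t0\<close>, so that the glued values at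
  \<open>(s0, t0)\<close> for \<open>c = 1\<close> and \<open>c = -1\<close> differ by twice the product of the two residual standard
  deviations.
\<close>

lemma two_amalgamations:
  assumes A: "covariance_on A LA" and B: "covariance_on B LB"
    and agree: "\<And>s t. s \<in> A \<inter> B \<Longrightarrow> t \<in> A \<inter> B \<Longrightarrow> LA (s, t) = LB (s, t)"
    and s0: "s0 \<in> A - B" "delta s0 \<notin> closed_span LA (A \<inter> B)"
    and t0: "t0 \<in> B - A" "delta t0 \<notin> closed_span LB (A \<inter> B)"
  shows "\<exists>L L'. L (s0, t0) \<noteq> L' (s0, t0) \<and> (\<forall>N\<in>{L, L'}. covariance_on (A \<union> B) N \<and>
    (\<forall>s\<in>A. \<forall>t\<in>A. N (s, t) = LA (s, t)) \<and> (\<forall>s\<in>B. \<forall>t\<in>B. N (s, t) = LB (s, t)))"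
proof -
  define M where "M = (\<lambda>(s, t). if s \<in> A \<and> t \<in> A then LA (s, t) else LB (s, t))"
  have MA: "M (s, t) = LA (s, t)" if "s \<in> A" "t \<in> A" for s t using that by (simp add: M_def)
  have MB: "M (s, t) = LB (s, t)" if "s \<in> B" "t \<in> B" for s t using that agree by (simp add: M_def)
  have A': "covariance_on A M" using covariance_cong[OF A] MA by blast
  have B': "covariance_on B M" using covariance_cong[OF B] MB by blast
  have CA: "A \<inter> B \<subseteq> A" and CB: "A \<inter> B \<subseteq> B" by auto
  let ?R = "residual M (A \<inter> B)"
  note RA = covariance_residual[OF A' CA] and RB = covariance_residual[OF B' CB]
  have "delta s0 \<notin> closed_span M (A \<inter> B)"
    using closed_span_cong[of A M LA "A \<inter> B" "delta s0"] MA s0 delta_in_fsupp[of s0 A] by auto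
  then have Rs: "?R (s0, s0) > 0"
    using residual_diag_zero_iff[OF A' CA, of s0] covariance_diag_nonneg[OF RA, of s0] s0 by auto
  have "delta t0 \<notin> closed_span M (A \<inter> B)"
    using closed_span_cong[of B M LB "A \<inter> B" "delta t0"] MB t0 delta_in_fsupp[of t0 B] by auto
  then have Rt: "?R (t0, t0) > 0"
    using residual_diag_zero_iff[OF B' CB, of t0] covariance_diag_nonneg[OF RB, of t0] t0 by auto
  define u where "u s = (if s \<in> A then ?R (s0, s) / sqrt (?R (s0, s0)) else 0)" for s
  define v where "v s = (if s \<in> B then ?R (t0, s) / sqrt (?R (t0, t0)) else 0)" for s
  have u: "covariance_on A (\<lambda>(s, t). ?R (s, t) - u s * u t)"
    by (rule covariance_cong[OF covariance_minus_rank_one[OF RA, of s0]]) (use s0 in \<open>auto simp: u_def\<close>)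
  have v: "covariance_on B (\<lambda>(s, t). ?R (s, t) - v s * v t)"
    by (rule covariance_cong[OF covariance_minus_rank_one[OF RB, of t0]]) (use t0 in \<open>auto simp: v_def\<close>)
  have u0: "u s = 0" if "s \<in> B" for s
    using that s0 residual_zero_right[OF A' CA, of s0 s] by (auto simp: u_def)
  have v0: "v s = 0" if "s \<in> A" for s
    using that t0 residual_zero_right[OF B' CB, of t0 s] by (auto simp: v_def)
  have uv: "u s0 * v t0 > 0" using Rs Rt s0 t0 by (simp add: u_def v_def)
  let ?g = "energy_inner (A \<inter> B) M (\<lambda>x. M (s0, x)) (\<lambda>x. M (t0, x))"
  have ex: "\<exists>L. covariance_on (A \<union> B) L \<and> (\<forall>s\<in>A. \<forall>t\<in>A. L (s, t) = LA (s, t)) \<and>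
      (\<forall>s\<in>B. \<forall>t\<in>B. L (s, t) = LB (s, t)) \<and> L (s0, t0) = ?g + c * u s0 * v t0"
    if c: "c\<^sup>2 = 1" for c :: real
  proof -
    obtain L where "covariance_on (A \<union> B) L"
      "\<And>s t. s \<in> A \<Longrightarrow> t \<in> A \<Longrightarrow> L (s, t) = M (s, t)"
      "\<And>s t. s \<in> B \<Longrightarrow> t \<in> B \<Longrightarrow> L (s, t) = M (s, t)"
      "\<And>s t. s \<in> A - B \<Longrightarrow> t \<in> B - A \<Longrightarrow>
        L (s, t) = energy_inner (A \<inter> B) M (\<lambda>x. M (s, x)) (\<lambda>x. M (t, x)) + c * u s * v t"
      using glue_covariances[OF A' B' u v u0 v0 c] by blast
    then show ?thesis using MA MB s0 t0 by (intro exI[of _ L]) simp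
  qed
  obtain L L' where "covariance_on (A \<union> B) L \<and> (\<forall>s\<in>A. \<forall>t\<in>A. L (s, t) = LA (s, t)) \<and>
      (\<forall>s\<in>B. \<forall>t\<in>B. L (s, t) = LB (s, t)) \<and> L (s0, t0) = ?g + 1 * u s0 * v t0"
    "covariance_on (A \<union> B) L' \<and> (\<forall>s\<in>A. \<forall>t\<in>A. L' (s, t) = LA (s, t)) \<and>
      (\<forall>s\<in>B. \<forall>t\<in>B. L' (s, t) = LB (s, t)) \<and> L' (s0, t0) = ?g + (-1) * u s0 * v t0"
    using ex[of 1] ex[of "-1"] by auto
  then show ?thesis using uv by (intro exI[of _ L] exI[of _ L']) auto
qed

text \<open>
  If \<open>k\<^sub>y\<close> is within \<open>\<epsilon>\<close> of a combination supported in \<open>X \<inter> Y\<close>, its covariance with \<open>x \<in> X\<close> is,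
  up to \<open>\<epsilon> \<parallel>k\<^sub>x\<parallel>\<close>, a combination of values on \<open>X \<times> X\<close>. Both the distance and these values are
  the same for the two covariances.
\<close>

lemma covariances_agree_on_union:
  assumes L: "covariance_on (X \<union> Y) L" and L': "covariance_on (X \<union> Y) L'"
    and X: "\<And>s t. s \<in> X \<Longrightarrow> t \<in> X \<Longrightarrow> L (s, t) = L' (s, t)"
    and Y: "\<And>s t. s \<in> Y \<Longrightarrow> t \<in> Y \<Longrightarrow> L (s, t) = L' (s, t)"
    and span: "\<And>y. y \<in> Y \<Longrightarrow> delta y \<in> closed_span L (X \<inter> Y)"
    and s: "s \<in> X \<union> Y" and t: "t \<in> X \<union> Y"
  shows "L (s, t) = L' (s, t)"
proof -
  have cross: "L (x, y) = L' (x, y)" if x: "x \<in> X" and y: "y \<in> Y" for x y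
  proof (rule ccontr)
    \<comment> \<open>The approximation error below is calibrated to bound \<open>d\<close> by \<open>d k / (k + 1) < d\<close>.\<close>
    define d where "d = (L (x, y) - L' (x, y))\<^sup>2"
    define k where "k = L (x, x)"
    assume "L (x, y) \<noteq> L' (x, y)"
    then have d: "d > 0" by (simp add: d_def)
    have k: "k \<ge> 0" "L' (x, x) = k" using covariance_diag_nonneg[OF L, of x] X x by (auto simp: k_def)
    have "d / (4 * (k + 1)) > 0" using d k by simp
    then obtain \<beta> where \<beta>: "\<beta> \<in> fsupp (X \<inter> Y)"
        and small: "form L (\<lambda>z. delta y z - \<beta> z) (\<lambda>z. delta y z - \<beta> z) < d / (4 * (k + 1))"
      using span[OF y] unfolding closed_span_def by blast
    let ?r = "\<lambda>z. delta y z - \<beta> z"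
    have rY: "?r \<in> fsupp Y" using fsupp_mono[OF \<beta>] by (intro fsupp_diff delta_in_fsupp y) auto
    then have r: "?r \<in> fsupp (X \<union> Y)" by (rule fsupp_mono) auto
    have rL: "form L ?r ?r = form L' ?r ?r" using form_cong[OF rY rY] Y by blast
    have app: "N (x, y) - pairing \<beta> (\<lambda>z. N (x, z)) = form N (delta x) ?r" for N
    proof -
      have "form N (delta x) (\<lambda>z. 1 * delta y z + (-1) * \<beta> z) = N (x, y) - pairing \<beta> (\<lambda>z. N (x, z))"
        using pairing_lincomb_left[OF delta_in_fsupp[of y UNIV] fsupp_mono[OF \<beta>, of UNIV], of 1 "-1" "\<lambda>z. N (x, z)"]
        by simp
      then show ?thesis by simp
    qed
    have CS: "(N (x, y) - pairing \<beta> (\<lambda>z. N (x, z)))\<^sup>2 \<le> N (x, x) * form N ?r ?r"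
      if "covariance_on (X \<union> Y) N" for N
      using form_Cauchy_Schwarz[OF that delta_in_fsupp[of x] r] x unfolding app by simp
    have same: "pairing \<beta> (\<lambda>z. L' (x, z)) = pairing \<beta> (\<lambda>z. L (x, z))"
      using X x by (intro pairing_cong[OF \<beta>]) auto
    have sq: "(a - b)\<^sup>2 \<le> 2 * (a - p)\<^sup>2 + 2 * (b - p)\<^sup>2" for a b p :: real
      using zero_le_power2[of "a + b - 2 * p"] by (simp add: power2_eq_square algebra_simps)
    have "d \<le> 4 * (k * form L ?r ?r)"
      using sq[of "L (x, y)" "L' (x, y)" "pairing \<beta> (\<lambda>z. L (x, z))"] CS[OF L] CS[OF L']
      unfolding same rL[symmetric] k(2) k_def[symmetric] d_def[symmetric] by linarith
    also have "\<dots> \<le> 4 * (k * (d / (4 * (k + 1))))"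
      using small k by (intro mult_left_mono) auto
    also have "\<dots> < d" using d k by (simp add: field_simps)
    finally show False by simp
  qed
  show ?thesis
    using s t X Y cross covariance_commute[OF L, of s t] covariance_commute[OF L', of s t] by auto
qed

section \<open>Naturally ordered intervals\<close>

text \<open>
  A point common to an earlier and a later interval but missing from one in between would lie both
  to the left and to the right of the latter.
\<close>

lemma naturally_ordered_between:
  assumes ord: "naturally_ordered m J" and "1 \<le> i" "i \<le> p" "p \<le> k" "k \<le> m" and "J p \<noteq> {}"
  shows "J i \<inter> J k \<subseteq> J p"
proof
  fix x assume x: "x \<in> J i \<inter> J k"
  show "x \<in> J p"
  proof (rule ccontr)
    assume nx: "x \<notin> J p"
    then have "i < p" "p < k" using x assms(3,4) by (metis IntD1 IntD2 le_neq_implies_less)+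
    obtain y where y: "y \<in> J p" using \<open>J p \<noteq> {}\<close> by blast
    have idx: "i \<in> {1..m}" "p \<in> {1..m}" "k \<in> {1..m}" using assms by auto
    have "x < y"
      using bspec[OF bspec[OF ord[unfolded naturally_ordered_def] idx(1)] idx(2)] \<open>i < p\<close> x y nx by blast
    moreover have "y < x"
      using bspec[OF bspec[OF ord[unfolded naturally_ordered_def] idx(2)] idx(3)] \<open>p < k\<close> x y nx by blast
    ultimately show False by simp
  qed
qed

text \<open>
  This makes \<open>J p \<inter> J (p + 1)\<close> the only place where a left block and a right block of intervals
  are already linked, so that gluing blocks involves the same overlaps as the Schur complements.
\<close>

lemma naturally_ordered_cut:
  assumes ord: "naturally_ordered m J" and ne: "\<And>j. j \<in> {1..m} \<Longrightarrow> J j \<noteq> {}"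
    and "1 \<le> a" "a \<le> p" "p < b" "b \<le> m"
  shows "(\<Union>j\<in>{a..p}. J j) \<inter> (\<Union>j\<in>{p + 1..b}. J j) = J p \<inter> J (p + 1)"
proof (intro equalityI subsetI)
  fix x assume "x \<in> (\<Union>j\<in>{a..p}. J j) \<inter> (\<Union>j\<in>{p + 1..b}. J j)"
  then obtain i k where ik: "i \<in> {a..p}" "k \<in> {p + 1..b}" "x \<in> J i \<inter> J k" by blast
  have "J i \<inter> J k \<subseteq> J p" "J i \<inter> J k \<subseteq> J (p + 1)"
    using ik assms by (intro naturally_ordered_between[OF ord] ne; simp)+
  then show "x \<in> J p \<inter> J (p + 1)" using ik by blast
qed (use assms in auto)

lemma exists_completion_of_consecutive:
  assumes ord: "naturally_ordered m J" and ne: "\<And>j. j \<in> {1..m} \<Longrightarrow> J j \<noteq> {}"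
    and cov: "\<And>j. j \<in> {1..m} \<Longrightarrow> covariance_on (J j) K"
    and "1 \<le> a" "a \<le> b" "b \<le> m"
  shows "\<exists>L. covariance_on (\<Union>j\<in>{a..b}. J j) L \<and>
    (\<forall>j\<in>{a..b}. \<forall>s\<in>J j. \<forall>t\<in>J j. L (s, t) = K (s, t))"
  using \<open>a \<le> b\<close> \<open>b \<le> m\<close>
proof (induction b rule: dec_induct)
  case base
  then show ?case using cov[of a] \<open>1 \<le> a\<close> by (intro exI[of _ K]) simp
next
  case (step n)
  let ?X = "\<Union>j\<in>{a..n}. J j"
  obtain L where L: "covariance_on ?X L" "\<forall>j\<in>{a..n}. \<forall>s\<in>J j. \<forall>t\<in>J j. L (s, t) = K (s, t)"
    using step by auto
  have cut: "?X \<inter> J (Suc n) = J n \<inter> J (Suc n)"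
    using naturally_ordered_cut[OF ord ne, of a n "Suc n"] step \<open>1 \<le> a\<close> by simp
  have cov_next: "covariance_on (J (Suc n)) K" using step by (intro cov) simp
  have agree: "L (s, t) = K (s, t)" if "s \<in> ?X \<inter> J (Suc n)" "t \<in> ?X \<inter> J (Suc n)" for s t
    using that bspec[OF L(2), of n] step(1) unfolding cut by simp
  obtain L' where L': "covariance_on (?X \<union> J (Suc n)) L'"
    "\<And>s t. s \<in> ?X \<Longrightarrow> t \<in> ?X \<Longrightarrow> L' (s, t) = L (s, t)"
    "\<And>s t. s \<in> J (Suc n) \<Longrightarrow> t \<in> J (Suc n) \<Longrightarrow> L' (s, t) = K (s, t)"
    using amalgamate_covariances[OF L(1) cov_next agree] by blast
  have range: "{a..Suc n} = insert (Suc n) {a..n}" using step(1) by (auto simp: le_Suc_eq)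
  have "covariance_on (\<Union>j\<in>{a..Suc n}. J j) L'" using L'(1) unfolding range by (simp add: Un_commute)
  moreover have "L' (s, t) = K (s, t)" if "j \<in> {a..Suc n}" "s \<in> J j" "t \<in> J j" for j s t
  proof (cases "j = Suc n")
    case False
    then have j: "j \<in> {a..n}" using that(1) by auto
    then have "s \<in> ?X" "t \<in> ?X" using that by blast+
    then show ?thesis using L'(2)[of s t] bspec[OF L(2) j] that by simp
  qed (use that L'(3) in simp)
  ultimately show ?case by blast
qed

section \<open>Unique completions\<close>

theorem theorem5p1:
  fixes I :: "real set" and m :: nat and J :: "nat \<Rightarrow> real set"
    and K :: "real \<times> real \<Rightarrow> real"
  assumes "is_interval I"
    and "interval_cover I m J"
    and "naturally_ordered m J"
    and "partial_covariance_on I (serrated_domain m J) K"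
  shows "is_singleton (completions I (serrated_domain m J) K) \<longleftrightarrow>
    (\<exists>r\<in>{1..m}.
      (\<forall>p. 1 \<le> p \<and> p < r \<longrightarrow>
        (\<forall>s \<in> J p - J p \<inter> J (p + 1). \<forall>t \<in> J p - J p \<inter> J (p + 1).
          schur_complement K (J p) (J p \<inter> J (p + 1)) (s, t) = 0)) \<and>
      (\<forall>q. r \<le> q \<and> q < m \<longrightarrow>
        (\<forall>s \<in> J (q + 1) - J q \<inter> J (q + 1). \<forall>t \<in> J (q + 1) - J q \<inter> J (q + 1).
          schur_complement K (J (q + 1)) (J q \<inter> J (q + 1)) (s, t) = 0)))"
proof -
  let ?\<Omega> = "serrated_domain m J"
  define left where "left p \<longleftrightarrow> (\<forall>s\<in>J p. delta s \<in> closed_span K (J p \<inter> J (p + 1)))" for p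
  define right where "right q \<longleftrightarrow> (\<forall>s\<in>J (q + 1). delta s \<in> closed_span K (J q \<inter> J (q + 1)))" for q
  have m: "m \<ge> 1" and ne: "\<And>j. j \<in> {1..m} \<Longrightarrow> J j \<noteq> {}" and JI: "\<And>j. j \<in> {1..m} \<Longrightarrow> J j \<subseteq> I"
    and cover: "(\<Union>j\<in>{1..m}. J j) = I"
    using assms(2) by (auto simp: interval_cover_def)
  note ord = assms(3)
  have cov: "covariance_on (J j) K" if "j \<in> {1..m}" for j
  proof -
    have "J j \<times> J j \<subseteq> ?\<Omega>" using that by (auto simp: serrated_domain_def)
    then show ?thesis using assms(4) JI[OF that] by (simp add: partial_covariance_on_def)
  qed
  have cut: "(\<Union>j\<in>{a..p}. J j) \<inter> (\<Union>j\<in>{p + 1..b}. J j) = J p \<inter> J (p + 1)"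
    if "1 \<le> a" "a \<le> p" "p < b" "b \<le> m" for a p b
    by (rule naturally_ordered_cut[OF ord ne that])
  have left_iff: "(\<forall>s \<in> J p - J p \<inter> J (p + 1). \<forall>t \<in> J p - J p \<inter> J (p + 1).
      schur_complement K (J p) (J p \<inter> J (p + 1)) (s, t) = 0) \<longleftrightarrow> left p" if "1 \<le> p" "p < m" for p
    unfolding left_def using that by (intro schur_complement_zero_iff cov) auto
  have right_iff: "(\<forall>s \<in> J (q + 1) - J q \<inter> J (q + 1). \<forall>t \<in> J (q + 1) - J q \<inter> J (q + 1).
      schur_complement K (J (q + 1)) (J q \<inter> J (q + 1)) (s, t) = 0) \<longleftrightarrow> right q" if "1 \<le> q" "q < m" for q
    unfolding right_def using that by (intro schur_complement_zero_iff cov) auto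
  have completionI: "restrict L (I \<times> I) \<in> completions I ?\<Omega> K"
    if L: "covariance_on I L" "\<And>j s t. j \<in> {1..m} \<Longrightarrow> s \<in> J j \<Longrightarrow> t \<in> J j \<Longrightarrow> L (s, t) = K (s, t)" for L
  proof -
    have "covariance_on I (restrict L (I \<times> I))" by (rule covariance_cong[OF L(1)]) simp
    then show ?thesis using L(2) JI unfolding completions_def serrated_domain_def by fastforce
  qed
  have completionD: "covariance_on I L" "L \<in> extensional (I \<times> I)"
    "\<And>j s t. j \<in> {1..m} \<Longrightarrow> s \<in> J j \<Longrightarrow> t \<in> J j \<Longrightarrow> L (s, t) = K (s, t)"
    if "L \<in> completions I ?\<Omega> K" for L
    using that unfolding completions_def serrated_domain_def by auto

  have "is_singleton (completions I ?\<Omega> K) \<longleftrightarrow>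
    (\<exists>r\<in>{1..m}. (\<forall>p. 1 \<le> p \<and> p < r \<longrightarrow> left p) \<and> (\<forall>q. r \<le> q \<and> q < m \<longrightarrow> right q))" (is "_ \<longleftrightarrow> ?II")
  proof
    assume ?II
    then obtain r where r: "r \<in> {1..m}" and left: "\<And>p. 1 \<le> p \<Longrightarrow> p < r \<Longrightarrow> left p"
      and right: "\<And>q. r \<le> q \<Longrightarrow> q < m \<Longrightarrow> right q" by blast
    obtain L where "covariance_on (\<Union>j\<in>{1..m}. J j) L"
        "\<forall>j\<in>{1..m}. \<forall>s\<in>J j. \<forall>t\<in>J j. L (s, t) = K (s, t)"
      using exists_completion_of_consecutive[OF ord ne cov, of 1 m] m by auto
    then have "completions I ?\<Omega> K \<noteq> {}" using completionI[of L] unfolding cover by blast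
    moreover have "L1 = L2" if L1: "L1 \<in> completions I ?\<Omega> K" and L2: "L2 \<in> completions I ?\<Omega> K" for L1 L2
    proof -
      note D1 = completionD[OF L1] and D2 = completionD[OF L2]
      have extend: "\<forall>s\<in>X \<union> J j. \<forall>t\<in>X \<union> J j. L1 (s, t) = L2 (s, t)"
        if j: "j \<in> {1..m}" and X: "X \<subseteq> I" "\<forall>s\<in>X. \<forall>t\<in>X. L1 (s, t) = L2 (s, t)"
          and span: "\<And>y. y \<in> J j \<Longrightarrow> delta y \<in> closed_span K (X \<inter> J j)" for X j
      proof (intro ballI)
        have sub: "X \<union> J j \<subseteq> I" using X JI[OF j] by blast
        have span1: "delta y \<in> closed_span L1 (X \<inter> J j)" if "y \<in> J j" for y
          using span[OF that] D1(3)[OF j] that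
            closed_span_cong[of "J j" K L1 "X \<inter> J j" "delta y"] delta_in_fsupp[OF that] by auto
        have XJ: "L1 (s, t) = L2 (s, t)" if "s \<in> J j" "t \<in> J j" for s t
          using D1(3)[OF j that] D2(3)[OF j that] by simp
        fix s t assume "s \<in> X \<union> J j" "t \<in> X \<union> J j"
        show "L1 (s, t) = L2 (s, t)"
          by (rule covariances_agree_on_union[where X = X and Y = "J j", OF covariance_subset[OF D1(1) sub]
                covariance_subset[OF D2(1) sub]]) (fact | use X(2) XJ span1 in blast)+
      qed
      have rightwards: "\<forall>s\<in>(\<Union>j\<in>{r..n}. J j). \<forall>t\<in>(\<Union>j\<in>{r..n}. J j). L1 (s, t) = L2 (s, t)"
        if "r \<le> n" "n \<le> m" for n
        using that
      proof (induction n rule: dec_induct)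
        case base
        then show ?case using D1(3)[OF r] D2(3)[OF r] by simp
      next
        case (step n)
        let ?X = "\<Union>j\<in>{r..n}. J j"
        have c: "?X \<inter> J (Suc n) = J n \<inter> J (n + 1)" using cut[of r n "n + 1"] step r by simp
        have "\<forall>s\<in>?X \<union> J (Suc n). \<forall>t\<in>?X \<union> J (Suc n). L1 (s, t) = L2 (s, t)"
        proof (rule extend)
          show "Suc n \<in> {1..m}" using step by simp
          show "?X \<subseteq> I" by (intro UN_least JI) (use step r in auto)
          show "\<forall>s\<in>?X. \<forall>t\<in>?X. L1 (s, t) = L2 (s, t)" using step by simp
          show "delta y \<in> closed_span K (?X \<inter> J (Suc n))" if "y \<in> J (Suc n)" for y
            unfolding c using right[of n] step that by (simp add: right_def)
        qed
        moreover have "{r..Suc n} = insert (Suc n) {r..n}" using step by (auto simp: le_Suc_eq)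
        ultimately show ?case by (simp add: Un_commute)
      qed
      have leftwards: "\<forall>s\<in>(\<Union>j\<in>{n..m}. J j). \<forall>t\<in>(\<Union>j\<in>{n..m}. J j). L1 (s, t) = L2 (s, t)"
        if "n \<le> r" "1 \<le> n" for n
        using that
      proof (induction n rule: inc_induct)
        case base
        then show ?case using rightwards[of m] r by simp
      next
        case (step n)
        let ?X = "\<Union>j\<in>{Suc n..m}. J j"
        have c: "?X \<inter> J n = J n \<inter> J (n + 1)" using cut[of n n m] step r by (simp add: Int_commute)
        have "\<forall>s\<in>?X \<union> J n. \<forall>t\<in>?X \<union> J n. L1 (s, t) = L2 (s, t)"
        proof (rule extend)
          show "n \<in> {1..m}" using step r by simp
          show "?X \<subseteq> I" by (intro UN_least JI) (use step r in auto)
          show "\<forall>s\<in>?X. \<forall>t\<in>?X. L1 (s, t) = L2 (s, t)" using step by simp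
          show "delta y \<in> closed_span K (?X \<inter> J n)" if "y \<in> J n" for y
            unfolding c using left[of n] step that by (simp add: left_def)
        qed
        moreover have "{n..m} = insert n {Suc n..m}" using step r by auto
        ultimately show ?case by (simp add: Un_commute)
      qed
      have "L1 (s, t) = L2 (s, t)" if "s \<in> I" "t \<in> I" for s t
        using leftwards[of 1] r that unfolding cover by simp
      then show ?thesis using D1(2) D2(2) by (intro extensionalityI[of L1 "I \<times> I" L2]) auto
    qed
    ultimately show "is_singleton (completions I ?\<Omega> K)" by (rule is_singletonI')
  next
    assume single: "is_singleton (completions I ?\<Omega> K)"
    show ?II
    proof (rule ccontr)
      assume II: "\<not> ?II"
      \<comment> \<open>If no left condition failed, \<open>r = m\<close> would do; taking \<open>r\<close> to be the first failing left
        index shows that some right condition fails at or after it.\<close>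
      have "\<exists>p q. 1 \<le> p \<and> p \<le> q \<and> q < m \<and> \<not> left p \<and> \<not> right q"
      proof -
        define a where "a = (LEAST p. 1 \<le> p \<and> \<not> left p)"
        obtain p where "1 \<le> p" "p < m" "\<not> left p" using II m by (auto dest!: bspec[of _ _ m])
        then have P: "1 \<le> p \<and> \<not> left p" by simp
        have a: "1 \<le> a" "\<not> left a" unfolding a_def using LeastI[of "\<lambda>p. 1 \<le> p \<and> \<not> left p", OF P] by blast+
        have "a \<le> p" unfolding a_def by (rule Least_le[of "\<lambda>p. 1 \<le> p \<and> \<not> left p", OF P])
        then have "a < m" using \<open>p < m\<close> by simp
        have "left k" if "1 \<le> k" "k < a" for k
          using not_less_Least[of k "\<lambda>p. 1 \<le> p \<and> \<not> left p"] that unfolding a_def by blast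
        moreover have "a \<in> {1..m}" using a \<open>a < m\<close> by simp
        ultimately have "\<not> (\<forall>q. a \<le> q \<and> q < m \<longrightarrow> right q)" using II by blast
        then show ?thesis using a by blast
      qed
      then obtain p' q where p': "1 \<le> p'" "p' \<le> q" "\<not> left p'" and q: "q < m" "\<not> right q" by blast
      \<comment> \<open>For \<open>p < k < q\<close> the vectors of \<open>J k\<close> then lie in the closed span of those of
        \<open>J (k + 1)\<close>, and those of \<open>J q\<close> in that of \<open>J q \<inter> J (q + 1)\<close>.\<close>
      define p where "p = Max {k\<in>{1..q}. \<not> left k}"
      have "p \<in> {k\<in>{1..q}. \<not> left k}" unfolding p_def using p' by (intro Max_in) auto
      then have p: "1 \<le> p" "p \<le> q" "\<not> left p" by auto
      have left: "left k" if "p < k" "k \<le> q" for k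
      proof (rule ccontr)
        assume "\<not> left k"
        then have "k \<le> p" unfolding p_def using that p by (intro Max_ge) auto
        then show False using that by simp
      qed
      obtain s0 where s0: "s0 \<in> J p" "delta s0 \<notin> closed_span K (J p \<inter> J (p + 1))"
        using p(3) by (auto simp: left_def)
      obtain t0 where t0: "t0 \<in> J (q + 1)" "delta t0 \<notin> closed_span K (J q \<inter> J (q + 1))"
        using q(2) by (auto simp: right_def)
      let ?A = "\<Union>j\<in>{1..p}. J j" and ?B = "\<Union>j\<in>{p + 1..m}. J j"
      obtain LA where LA: "covariance_on ?A LA" "\<forall>j\<in>{1..p}. \<forall>s\<in>J j. \<forall>t\<in>J j. LA (s, t) = K (s, t)"
        using exists_completion_of_consecutive[OF ord ne cov, of 1 p] p q by auto
      obtain LB where LB: "covariance_on ?B LB" "\<forall>j\<in>{p + 1..m}. \<forall>s\<in>J j. \<forall>t\<in>J j. LB (s, t) = K (s, t)"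
        using exists_completion_of_consecutive[OF ord ne cov, of "p + 1" m] p q by auto
      have C: "?A \<inter> ?B = J p \<inter> J (p + 1)" using cut[of 1 p m] p q by simp
      have agree: "LA (s, t) = LB (s, t)" if "s \<in> ?A \<inter> ?B" "t \<in> ?A \<inter> ?B" for s t
        using that bspec[OF LA(2), of p] bspec[OF LB(2), of "p + 1"] p q unfolding C by simp
      have s0A: "s0 \<in> ?A" using s0 p by auto
      have s0B: "s0 \<notin> ?B"
        using s0 s0A C fsupp_in_closed_span[OF delta_in_fsupp[of s0 "J p \<inter> J (p + 1)"]] by blast
      have s0_span: "delta s0 \<notin> closed_span LA (?A \<inter> ?B)"
        using closed_span_cong[of "J p" LA K "J p \<inter> J (p + 1)" "delta s0"] bspec[OF LA(2), of p] p s0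
          delta_in_fsupp[of s0 "J p"] unfolding C by simp
      have spanK: "delta x \<in> closed_span LB S \<longleftrightarrow> delta x \<in> closed_span K S"
        if "j \<in> {p + 1..m}" "x \<in> J j" "S \<subseteq> J j" for x S j
        using that LB(2) by (intro closed_span_cong[of "J j"] delta_in_fsupp) auto
      let ?D = "J q \<inter> J (q + 1)"
      have JB: "J j \<subseteq> ?B" if "j \<in> {p + 1..m}" for j using that by blast
      have DB: "?D \<subseteq> ?B" using JB[of "q + 1"] p q by auto
      have chain: "\<forall>x\<in>J k. delta x \<in> closed_span LB ?D" if "k \<le> q" "p < k" for k
        using that
      proof (induction k rule: inc_induct)
        case base
        then show ?case using left[of q] spanK[of q _ ?D] q by (auto simp: left_def)
      next
        case (step k)
        show ?case
        proof
          fix x assume x: "x \<in> J k"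
          have k: "k \<in> {p + 1..m}" "Suc k \<in> {p + 1..m}" using step q by auto
          have "delta x \<in> closed_span LB (J k \<inter> J (k + 1))"
            using left[of k] spanK[OF k(1) x] x step by (auto simp: left_def)
          then have span: "delta x \<in> closed_span LB (J (Suc k))" by (rule closed_span_mono) simp
          have supp: "delta x \<in> fsupp ?B" using x JB[OF k(1)] by (intro delta_in_fsupp) blast
          have points: "delta a \<in> closed_span LB ?D" if "a \<in> J (Suc k)" for a using step that by simp
          show "delta x \<in> closed_span LB ?D"
            by (rule closed_span_trans[OF LB(1) JB[OF k(2)] DB supp span points])
        qed
      qed
      have CD: "delta x \<in> closed_span LB ?D" if "x \<in> ?A \<inter> ?B" for x
      proof (cases "p = q")
        case True
        then have "x \<in> ?D" using that unfolding C by simp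
        then show ?thesis by (intro fsupp_in_closed_span delta_in_fsupp)
      next
        case False
        then have "\<forall>x\<in>J (p + 1). delta x \<in> closed_span LB ?D" using p by (intro chain) auto
        moreover have "x \<in> J (p + 1)" using that unfolding C by simp
        ultimately show ?thesis by blast
      qed
      \<comment> \<open>Were \<open>t0\<close> in the closed span of the cut, it would be in that of \<open>?D\<close>.\<close>
      have t0_notD: "delta t0 \<notin> closed_span LB ?D"
        using spanK[of "q + 1" t0 ?D] t0 p q by auto
      have t0B: "t0 \<in> ?B" using t0 JB[of "q + 1"] p q by auto
      then have t0A: "t0 \<notin> ?A" using CD t0_notD by blast
      have t0_span: "delta t0 \<notin> closed_span LB (?A \<inter> ?B)"
      proof
        assume span: "delta t0 \<in> closed_span LB (?A \<inter> ?B)"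
        have "delta t0 \<in> closed_span LB ?D"
          by (rule closed_span_trans[OF LB(1) Int_lower2 DB delta_in_fsupp[OF t0B] span CD])
        then show False using t0_notD by simp
      qed
      have AB: "?A \<union> ?B = I"
      proof -
        have "{1..m} = {1..p} \<union> {p + 1..m}" using p q by auto
        then show ?thesis using cover by (simp add: UN_Un)
      qed
      have "s0 \<in> ?A - ?B" "t0 \<in> ?B - ?A" using s0A s0B t0A t0B by blast+
      then have glued: "\<exists>L L'. L (s0, t0) \<noteq> L' (s0, t0) \<and> (\<forall>N\<in>{L, L'}. covariance_on I N \<and>
          (\<forall>s\<in>?A. \<forall>t\<in>?A. N (s, t) = LA (s, t)) \<and> (\<forall>s\<in>?B. \<forall>t\<in>?B. N (s, t) = LB (s, t)))"
        using two_amalgamations[of ?A LA ?B LB s0 t0, OF LA(1) LB(1) _ _ s0_span _ t0_span, unfolded AB] agree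
        by blast
      obtain L L' where diff: "L (s0, t0) \<noteq> L' (s0, t0)"
        and both: "\<And>N. N \<in> {L, L'} \<Longrightarrow> covariance_on I N \<and>
          (\<forall>s\<in>?A. \<forall>t\<in>?A. N (s, t) = LA (s, t)) \<and> (\<forall>s\<in>?B. \<forall>t\<in>?B. N (s, t) = LB (s, t))"
        using glued by (elim exE conjE) blast
      have "restrict N (I \<times> I) \<in> completions I ?\<Omega> K" if "N \<in> {L, L'}" for N
      proof (rule completionI)
        show "covariance_on I N" using both[OF that] by blast
        fix j s t assume j: "j \<in> {1..m}" and st: "s \<in> J j" "t \<in> J j"
        show "N (s, t) = K (s, t)"
        proof (cases "j \<le> p")
          case True
          then have j': "j \<in> {1..p}" using j by simp
          then have "N (s, t) = LA (s, t)" using both[OF that] st by blast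
          then show ?thesis using LA(2) j' st by simp
        next
          case False
          then have j': "j \<in> {p + 1..m}" using j by simp
          then have "N (s, t) = LB (s, t)" using both[OF that] st by blast
          then show ?thesis using LB(2) j' st by simp
        qed
      qed
      then have "restrict L (I \<times> I) = restrict L' (I \<times> I)"
        using single by (auto simp: is_singleton_def)
      moreover have "(s0, t0) \<in> I \<times> I" using s0A t0B AB by blast
      ultimately have "L (s0, t0) = L' (s0, t0)" by (metis restrict_apply')
      then show False using diff by simp
    qed
  qed
  also have "?II \<longleftrightarrow> (\<exists>r\<in>{1..m}.
      (\<forall>p. 1 \<le> p \<and> p < r \<longrightarrow>
        (\<forall>s \<in> J p - J p \<inter> J (p + 1). \<forall>t \<in> J p - J p \<inter> J (p + 1).
          schur_complement K (J p) (J p \<inter> J (p + 1)) (s, t) = 0)) \<and>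
      (\<forall>q. r \<le> q \<and> q < m \<longrightarrow>
        (\<forall>s \<in> J (q + 1) - J q \<inter> J (q + 1). \<forall>t \<in> J (q + 1) - J q \<inter> J (q + 1).
          schur_complement K (J (q + 1)) (J q \<inter> J (q + 1)) (s, t) = 0)))"
    by (intro bex_cong refl conj_cong all_cong left_iff[symmetric] right_iff[symmetric]) auto
  finally show ?thesis .
qed

end
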